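(* There is a family of cardinality $2^{\aleph_0}$ of pairwise non-isomorphic torsion-free step-3 solvable groups, each of which is generated by two elements $x,y$ such that, with respect to the symmetric generating set $\{x,x^{-1},y,y^{-1}\}$, the spectrum of the group is $[-1,1]$.
   Context: For a group $G$ with a finite symmetric generating set $S=S^{-1}$, the Markov operator on $l^2(G)$ is $(Mf)(g)=\frac1{|S|}\sum_{s\in S}f(s^{-1}g)$, and the spectrum of $G$ (with respect to $S$) is the spectrum of the operator $M$. "Step-3 solvable" means solvable of derived length 3. *)

theory Defs
  imports
    "HOL-Analysis.Infinite_Sum"
    "HOL-Library.Equipollence"
    "HOL-Algebra.Solvable_Groups"
begin

definition torsion_free :: "('a, 'b) monoid_scheme \<Rightarrow> bool" where
  "torsion_free G \<longleftrightarrow>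
     (\<forall>g\<in>carrier G. \<forall>n::nat. n > 0 \<longrightarrow> g [^]\<^bsub>G\<^esub> n = \<one>\<^bsub>G\<^esub> \<longrightarrow> g = \<one>\<^bsub>G\<^esub>)"

(* Only meaningful if G is solvable: otherwise no such n need exist. *)
definition derived_length :: "('a, 'b) monoid_scheme \<Rightarrow> nat" where
  "derived_length G = (LEAST n. (derived G ^^ n) (carrier G) = {\<one>\<^bsub>G\<^esub>})"

definition step_solvable :: "nat \<Rightarrow> ('a, 'b) monoid_scheme \<Rightarrow> bool" where
  "step_solvable n G \<longleftrightarrow> solvable G \<and> derived_length G = n"

(* The complex Hilbert space l^2(A) of a set A, whose elements are represented by
   functions on the whole type that vanish outside A. *)
definition ell2_set :: "'a set \<Rightarrow> ('a \<Rightarrow> complex) set" where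
  "ell2_set A = {f. (\<forall>a. a \<notin> A \<longrightarrow> f a = 0) \<and> (\<lambda>a. (cmod (f a))\<^sup>2) summable_on A}"

definition ell2_norm :: "'a set \<Rightarrow> ('a \<Rightarrow> complex) \<Rightarrow> real" where
  "ell2_norm A f = sqrt (\<Sum>\<^sub>\<infinity>a\<in>A. (cmod (f a))\<^sup>2)"

(* Operators on l^2(A) are maps on the whole function type;
   their values outside ell2_set A are irrelevant. *)
definition ell2_bounded_operator ::
    "'a set \<Rightarrow> (('a \<Rightarrow> complex) \<Rightarrow> ('a \<Rightarrow> complex)) \<Rightarrow> bool" where
  "ell2_bounded_operator A T \<longleftrightarrow>
     (\<forall>f\<in>ell2_set A. T f \<in> ell2_set A) \<and>
     (\<forall>f\<in>ell2_set A. \<forall>h\<in>ell2_set A. T (\<lambda>a. f a + h a) = (\<lambda>a. T f a + T h a)) \<and>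
     (\<forall>c. \<forall>f\<in>ell2_set A. T (\<lambda>a. c * f a) = (\<lambda>a. c * T f a)) \<and>
     (\<exists>C. \<forall>f\<in>ell2_set A. ell2_norm A (T f) \<le> C * ell2_norm A f)"

definition ell2_spectrum ::
    "'a set \<Rightarrow> (('a \<Rightarrow> complex) \<Rightarrow> ('a \<Rightarrow> complex)) \<Rightarrow> complex set" where
  "ell2_spectrum A T =
     {z. \<not> (\<exists>R. ell2_bounded_operator A R \<and>
              (\<forall>f\<in>ell2_set A. R (\<lambda>a. T f a - z * f a) = f \<and>
                              (\<lambda>a. T (R f) a - z * R f a) = f))}"

definition markov_operator ::
    "('a, 'b) monoid_scheme \<Rightarrow> 'a set \<Rightarrow> ('a \<Rightarrow> complex) \<Rightarrow> ('a \<Rightarrow> complex)" where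
  "markov_operator G S f =
     (\<lambda>g. if g \<in> carrier G
          then 1 / of_nat (card S) * (\<Sum>s\<in>S. f (inv\<^bsub>G\<^esub> s \<otimes>\<^bsub>G\<^esub> g)) else 0)"

definition group_spectrum :: "('a, 'b) monoid_scheme \<Rightarrow> 'a set \<Rightarrow> complex set" where
  "group_spectrum G S = ell2_spectrum (carrier G) (markov_operator G S)"

end

theory Submission
  imports
    Defs
    "HOL-Analysis.L2_Norm"
    "HOL-Library.Poly_Mapping"
    "HOL-Computational_Algebra.Primes"
begin

text \<open>
The groups are central extensions in the style of P. Hall. Let \<open>C\<close> be the subgroup
\<open>\<int>[1/p : p \<in> P]\<close> of the rationals, for a set \<open>P\<close> of primes. Take generators \<open>t\<close> and
\<open>a\<^sub>i\<close> (\<open>i\<close> an integer), let \<open>t\<close> shift the \<open>a\<^sub>i\<close>, and let the commutator of \<open>a\<^sub>i\<close> and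
\<open>a\<^sub>j\<close> be a central element of \<open>C\<close> that depends only on \<open>j - i\<close>. Modulo \<open>C\<close> this is the wreath
product of \<open>\<int>\<close> by \<open>\<int>\<close>. If the commutators of \<open>a\<^sub>0\<close> with \<open>a\<^sub>1, a\<^sub>2, \<dots>\<close> enumerate \<open>C\<close>, then
\<open>x = t\<close> and \<open>y = t a\<^sub>0\<close> generate the group (\<open>generate_hall\<close>). The group is torsion-free because
its three layers \<open>C\<close>, \<open>\<Oplus>\<int>\<close> and \<open>\<int>\<close> are. The third derived subgroup is trivial, since the
second one lies in \<open>C\<close>; the second one is not trivial, since it contains the second differences
of the enumeration of \<open>C\<close> (\<open>derived_hall_nontrivial\<close>).

The centre of the group is exactly \<open>C\<close>, and \<open>C\<close> is divisible by a prime \<open>p\<close> if and only if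
\<open>p \<in> P\<close>. So the isomorphism type of the group determines \<open>P\<close>, and there are as many groups as
there are sets of primes.

For the spectrum, let \<open>\<phi>\<close> be the homomorphism to \<open>\<int>\<close> that maps both \<open>x\<close> and \<open>y\<close> to \<open>1\<close>. The
group is solvable, hence amenable, and it has explicit Foelner sets (\<open>foelner_hall\<close>). The
indicator of a Foelner set multiplied by the character \<open>g \<mapsto> exp (i \<theta> \<phi>(g))\<close> is an approximate
eigenvector of the Markov operator: translation by \<open>x\<close> or \<open>y\<close> multiplies it nearly by
\<open>exp (- i \<theta>)\<close>, translation by their inverses nearly by \<open>exp (i \<theta>)\<close>, and the average is
\<open>cos \<theta>\<close> (\<open>cos_in_group_spectrum\<close>). So the spectrum contains \<open>[-1, 1]\<close>. It contains nothing else
because the Markov operator is a self-adjoint contraction (\<open>spectrum_symmetric_contraction\<close>).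

The groups are built on triples of an integer, a finitely supported integer function and a
rational number. This set is countable, and a bijection with a set of natural numbers carries all
the properties over.
\<close>

section \<open>Square-summable functions and resolvents\<close>

text \<open>
All estimates are made on finite sets, where the triangle inequality is known for the Euclidean
norm \<open>L2_set\<close>; this criterion and its converse \<open>L2_set_le_ell2_norm\<close> transfer them.
\<close>
lemma ell2_setI_bounded:
  assumes "\<And>a. a \<notin> A \<Longrightarrow> f a = 0"
    and "\<And>F. finite F \<Longrightarrow> F \<subseteq> A \<Longrightarrow> L2_set (\<lambda>a. cmod (f a)) F \<le> K"
  shows "f \<in> ell2_set A" and "ell2_norm A f \<le> K"
proof -
  have K: "0 \<le> K"
    using assms(2)[of "{}"] by simp
  have le: "(\<Sum>a\<in>F. (cmod (f a))\<^sup>2) \<le> K\<^sup>2" if "finite F" "F \<subseteq> A" for F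
    using assms(2)[OF that] K by (simp add: L2_set_def sqrt_le_D)
  have sum: "(\<lambda>a. (cmod (f a))\<^sup>2) summable_on A"
    by (rule nonneg_bdd_above_summable_on) (auto intro!: bdd_aboveI[of _ "K\<^sup>2"] le)
  then show "f \<in> ell2_set A"
    using assms(1) by (simp add: ell2_set_def)
  show "ell2_norm A f \<le> K"
    unfolding ell2_norm_def using infsum_le_finite_sums[OF sum le] K
    by (intro real_le_lsqrt) (auto intro: infsum_nonneg)
qed

lemma L2_set_le_ell2_norm:
  assumes "f \<in> ell2_set A" "finite F" "F \<subseteq> A"
  shows "L2_set (\<lambda>a. cmod (f a)) F \<le> ell2_norm A f"
  using assms unfolding ell2_norm_def L2_set_def ell2_set_def
  by (auto intro!: finite_sum_le_infsum)

lemma ell2_norm_nonneg [simp]: "0 \<le> ell2_norm A f"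
  by (simp add: ell2_norm_def infsum_nonneg)

lemma ell2_outside: "f \<in> ell2_set A \<Longrightarrow> a \<notin> A \<Longrightarrow> f a = 0"
  by (simp add: ell2_set_def)

lemma norm_le_ell2_norm:
  assumes "f \<in> ell2_set A"
  shows "cmod (f a) \<le> ell2_norm A f"
proof (cases "a \<in> A")
  case True
  then show ?thesis using L2_set_le_ell2_norm[OF assms, of "{a}"] by (simp add: L2_set_def)
qed (simp add: ell2_outside[OF assms])

lemma
  assumes "f \<in> ell2_set A" "h \<in> ell2_set A"
  shows ell2_add: "(\<lambda>a. f a + h a) \<in> ell2_set A"
    and ell2_norm_triangle: "ell2_norm A (\<lambda>a. f a + h a) \<le> ell2_norm A f + ell2_norm A h"
proof -
  have "L2_set (\<lambda>a. cmod (f a + h a)) F \<le> ell2_norm A f + ell2_norm A h"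
    if "finite F" "F \<subseteq> A" for F
  proof -
    have "L2_set (\<lambda>a. cmod (f a + h a)) F \<le> L2_set (\<lambda>a. cmod (f a) + cmod (h a)) F"
      by (intro L2_set_mono) (auto intro: norm_triangle_ineq)
    also have "\<dots> \<le> L2_set (\<lambda>a. cmod (f a)) F + L2_set (\<lambda>a. cmod (h a)) F"
      by (rule L2_set_triangle_ineq)
    also have "\<dots> \<le> ell2_norm A f + ell2_norm A h"
      using assms that by (intro add_mono L2_set_le_ell2_norm)
    finally show ?thesis .
  qed
  moreover have "f a + h a = 0" if "a \<notin> A" for a
    using assms that by (simp add: ell2_outside)
  ultimately show "(\<lambda>a. f a + h a) \<in> ell2_set A"
    "ell2_norm A (\<lambda>a. f a + h a) \<le> ell2_norm A f + ell2_norm A h"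
    using ell2_setI_bounded[of A "\<lambda>a. f a + h a" "ell2_norm A f + ell2_norm A h"] by blast+
qed

lemma ell2_scale: "f \<in> ell2_set A \<Longrightarrow> (\<lambda>a. c * f a) \<in> ell2_set A"
  by (auto simp: ell2_set_def norm_mult power_mult_distrib intro: summable_on_cmult_right)

lemma ell2_norm_scale: "ell2_norm A (\<lambda>a. c * f a) = cmod c * ell2_norm A f"
  by (simp add: ell2_norm_def norm_mult power_mult_distrib infsum_cmult_right' real_sqrt_mult)

lemma ell2_diff: "f \<in> ell2_set A \<Longrightarrow> h \<in> ell2_set A \<Longrightarrow> (\<lambda>a. f a - h a) \<in> ell2_set A"
  using ell2_add[of f A "\<lambda>a. -1 * h a"] ell2_scale[of h A "-1"] by simp

lemma ell2_zero [simp]: "(\<lambda>_. 0) \<in> ell2_set A"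
  by (simp add: ell2_set_def)

lemma
  assumes "finite I" "\<And>i. i \<in> I \<Longrightarrow> f i \<in> ell2_set A"
  shows ell2_sum: "(\<lambda>a. \<Sum>i\<in>I. f i a) \<in> ell2_set A"
    and ell2_norm_sum: "ell2_norm A (\<lambda>a. \<Sum>i\<in>I. f i a) \<le> (\<Sum>i\<in>I. ell2_norm A (f i))"
proof -
  have "(\<lambda>a. \<Sum>i\<in>I. f i a) \<in> ell2_set A \<and> ell2_norm A (\<lambda>a. \<Sum>i\<in>I. f i a) \<le> (\<Sum>i\<in>I. ell2_norm A (f i))"
    using assms
  proof (induction rule: finite_induct)
    case empty
    then show ?case by (simp add: ell2_norm_def)
  next
    case (insert i I)
    then have "ell2_norm A (\<lambda>a. f i a + (\<Sum>i\<in>I. f i a)) \<le> ell2_norm A (f i) + ell2_norm A (\<lambda>a. \<Sum>i\<in>I. f i a)"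
      by (intro ell2_norm_triangle) auto
    then show ?case using insert by (auto intro!: ell2_add)
  qed
  then show "(\<lambda>a. \<Sum>i\<in>I. f i a) \<in> ell2_set A" "ell2_norm A (\<lambda>a. \<Sum>i\<in>I. f i a) \<le> (\<Sum>i\<in>I. ell2_norm A (f i))"
    by auto
qed

text \<open>
A form of Fatou's lemma: bounds on finite partial sums survive pointwise limits. It takes the place
of the completeness of \<open>l\<^sup>2\<close> below.
\<close>
lemma ell2_limit:
  assumes f: "\<And>n. f n \<in> ell2_set A" "\<And>n. ell2_norm A (f n) \<le> K"
    and lim: "\<And>a. (\<lambda>n. f n a) \<longlonglongrightarrow> g a"
  shows "g \<in> ell2_set A" and "ell2_norm A g \<le> K"
proof -
  have "g a = 0" if "a \<notin> A" for a
    proof -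
    have "f n a = 0" for n
      using f(1) that by (rule ell2_outside)
    then show ?thesis
      using lim[of a] by (simp add: LIMSEQ_const_iff)
  qed
  moreover have "L2_set (\<lambda>a. cmod (g a)) F \<le> K" if "finite F" "F \<subseteq> A" for F
  proof (rule LIMSEQ_le_const2)
    show "(\<lambda>n. L2_set (\<lambda>a. cmod (f n a)) F) \<longlonglongrightarrow> L2_set (\<lambda>a. cmod (g a)) F"
      unfolding L2_set_def by (intro tendsto_intros lim)
    show "\<exists>N. \<forall>n\<ge>N. L2_set (\<lambda>a. cmod (f n a)) F \<le> K"
      using L2_set_le_ell2_norm[OF f(1) that] f(2) by (blast intro: order_trans)
  qed
  ultimately show "g \<in> ell2_set A" "ell2_norm A g \<le> K"
    using ell2_setI_bounded[of A g K] by blast+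
qed

lemma ell2_bounded_operatorD:
  assumes "ell2_bounded_operator A T" "f \<in> ell2_set A"
  shows "T f \<in> ell2_set A"
    and "h \<in> ell2_set A \<Longrightarrow> T (\<lambda>a. f a + h a) = (\<lambda>a. T f a + T h a)"
    and "T (\<lambda>a. c * f a) = (\<lambda>a. c * T f a)"
  using assms by (auto simp: ell2_bounded_operator_def)

text \<open>
An inverse of \<open>T - z\<close> bounded by \<open>C\<close> would give \<open>\<parallel>f\<parallel> \<le> C \<parallel>(T - z) f\<parallel>\<close>, which fails for approximate
eigenvectors as soon as \<open>C e < 1\<close>.
\<close>
lemma approximate_eigenvalue_in_spectrum:
  assumes T: "ell2_bounded_operator A T"
    and approx: "\<And>e. 0 < e \<Longrightarrow> \<exists>f\<in>ell2_set A. 0 < ell2_norm A f \<and>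
      ell2_norm A (\<lambda>a. T f a - z * f a) \<le> e * ell2_norm A f"
  shows "z \<in> ell2_spectrum A T"
proof (rule ccontr)
  assume "z \<notin> ell2_spectrum A T"
  then obtain R where R: "ell2_bounded_operator A R"
    and inv: "\<And>f. f \<in> ell2_set A \<Longrightarrow> R (\<lambda>a. T f a - z * f a) = f"
    by (auto simp: ell2_spectrum_def)
  from R obtain C where C: "\<And>f. f \<in> ell2_set A \<Longrightarrow> ell2_norm A (R f) \<le> C * ell2_norm A f"
    unfolding ell2_bounded_operator_def by blast
  define e where "e = 1 / (2 * (\<bar>C\<bar> + 1))"
  have e: "0 < e" "\<bar>C\<bar> * e < 1"
    by (auto simp: e_def divide_simps)
  obtain f where f: "f \<in> ell2_set A" "0 < ell2_norm A f"
    "ell2_norm A (\<lambda>a. T f a - z * f a) \<le> e * ell2_norm A f"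
    using approx[OF e(1)] by blast
  have "(\<lambda>a. T f a - z * f a) \<in> ell2_set A"
    by (intro ell2_diff ell2_scale ell2_bounded_operatorD(1)[OF T] f(1))
  then have "ell2_norm A f \<le> C * ell2_norm A (\<lambda>a. T f a - z * f a)"
    using C inv[OF f(1)] by metis
  also have "\<dots> \<le> \<bar>C\<bar> * (e * ell2_norm A f)"
    using f(3) by (intro mult_mono) auto
  finally show False
    using e(2) f(2) by (simp add: mult.assoc[symmetric] not_le[symmetric])
qed

text \<open>
If \<open>B = 1 - c (T - z)\<close> has norm at most \<open>q < 1\<close>, then the Neumann series \<open>S = \<Sum> B\<^sup>n\<close> inverts
\<open>c (T - z)\<close>. The series is summed pointwise; the geometric bound on its tails shows that the
partial sums \<open>P\<close> converge to \<open>S\<close> also in norm, which is needed to exchange \<open>B\<close> with the sum.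
The factor \<open>c\<close> lets the lemma cover points \<open>z\<close> near the spectrum as well as far from it.
\<close>
lemma not_in_spectrum_if_contraction:
  assumes T: "ell2_bounded_operator A T"
    and c: "c \<noteq> 0" and q: "0 \<le> q" "q < 1"
    and contr: "\<And>f. f \<in> ell2_set A \<Longrightarrow>
      ell2_norm A (\<lambda>a. f a - c * (T f a - z * f a)) \<le> q * ell2_norm A f"
  shows "z \<notin> ell2_spectrum A T"
proof -
  define B where "B f = (\<lambda>a. f a - c * (T f a - z * f a))" for f
  note Tset = ell2_bounded_operatorD(1)[OF T]
  have Bset: "B f \<in> ell2_set A" if "f \<in> ell2_set A" for f
    unfolding B_def by (intro ell2_diff ell2_scale Tset that)
  have B_add: "B (\<lambda>a. f a + h a) = (\<lambda>a. B f a + B h a)" if "f \<in> ell2_set A" "h \<in> ell2_set A" for f h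
    using ell2_bounded_operatorD(2)[OF T that] by (auto simp: B_def fun_eq_iff algebra_simps)
  have B_scale: "B (\<lambda>a. k * f a) = (\<lambda>a. k * B f a)" if "f \<in> ell2_set A" for f k
    using ell2_bounded_operatorD(3)[OF T that] by (auto simp: B_def fun_eq_iff algebra_simps)
  have B_norm: "ell2_norm A (B f) \<le> q * ell2_norm A f" if "f \<in> ell2_set A" for f
    using contr[OF that] by (simp add: B_def)
  have Bn: "(B ^^ n) f \<in> ell2_set A \<and> ell2_norm A ((B ^^ n) f) \<le> q ^ n * ell2_norm A f"
    if "f \<in> ell2_set A" for f n
  proof (induction n)
    case (Suc n)
    then have "ell2_norm A (B ((B ^^ n) f)) \<le> q * (q ^ n * ell2_norm A f)"
      using B_norm q(1) by (meson mult_left_mono order_trans)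
    then show ?case using Suc Bset by (simp add: mult.assoc)
  qed (simp add: that)
  have Bn_add: "(B ^^ n) (\<lambda>a. f a + h a) = (\<lambda>a. (B ^^ n) f a + (B ^^ n) h a)"
    if "f \<in> ell2_set A" "h \<in> ell2_set A" for f h n
    using that Bn by (induction n) (auto simp: B_add)
  have Bn_scale: "(B ^^ n) (\<lambda>a. k * f a) = (\<lambda>a. k * (B ^^ n) f a)" if "f \<in> ell2_set A" for f k n
    using that Bn by (induction n) (auto simp: B_scale)
  define P where "P h n = (\<lambda>a. \<Sum>i<n. (B ^^ i) h a)" for h n
  define S where "S h = (\<lambda>a. suminf (\<lambda>i. (B ^^ i) h a))" for h
  have Pset: "P h n \<in> ell2_set A" if "h \<in> ell2_set A" for h n
    unfolding P_def using Bn[OF that] by (intro ell2_sum) auto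
  have summ: "summable (\<lambda>i. (B ^^ i) h a)" if "h \<in> ell2_set A" for h a
  proof (rule summable_comparison_test')
    show "summable (\<lambda>n. q ^ n * ell2_norm A h)"
      using q by (intro summable_mult2 summable_geometric) auto
    show "norm ((B ^^ n) h a) \<le> q ^ n * ell2_norm A h" if "0 \<le> n" for n
      using Bn[OF \<open>h \<in> ell2_set A\<close>, of n] norm_le_ell2_norm[of "(B ^^ n) h" A a] by linarith
  qed
  have lim: "(\<lambda>n. P h n a) \<longlonglongrightarrow> S h a" if "h \<in> ell2_set A" for h a
    unfolding P_def S_def using summ[OF that] by (rule summable_LIMSEQ)
  have lim0: "(\<lambda>n. (B ^^ n) h a) \<longlonglongrightarrow> 0" if "h \<in> ell2_set A" for h a
    using summ[OF that] by (rule summable_LIMSEQ_zero)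
  have tail: "ell2_norm A (\<lambda>a. P h (m + n) a - P h n a) \<le> q ^ n / (1 - q) * ell2_norm A h"
    if "h \<in> ell2_set A" for h m n
  proof -
    have "(\<lambda>a. P h (m + n) a - P h n a) = (\<lambda>a. \<Sum>i\<in>{n..<m+n}. (B ^^ i) h a)"
      unfolding P_def by (auto simp: sum_diff_nat_ivl lessThan_atLeast0)
    then have "ell2_norm A (\<lambda>a. P h (m + n) a - P h n a) \<le> (\<Sum>i\<in>{n..<m+n}. ell2_norm A ((B ^^ i) h))"
      using ell2_norm_sum[of "{n..<m+n}" "\<lambda>i. (B ^^ i) h" A] Bn[OF that] by simp
    also have "\<dots> \<le> (\<Sum>i\<in>{n..<m+n}. q ^ i * ell2_norm A h)"
      using Bn[OF that] by (intro sum_mono) auto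
    also have "\<dots> = q ^ n * (\<Sum>i<m. q ^ i) * ell2_norm A h"
      using sum.shift_bounds_nat_ivl[of "\<lambda>i. q ^ i * ell2_norm A h" 0 n m]
      by (simp add: sum_distrib_left sum_distrib_right lessThan_atLeast0 power_add ac_simps)
    also have "(\<Sum>i<m. q ^ i) \<le> 1 / (1 - q)"
      using q by (simp add: sum_gp_strict divide_simps)
    finally show ?thesis
      using q by (simp add: mult_left_mono mult_right_mono)
  qed
  have close: "S h \<in> ell2_set A"
    "ell2_norm A (\<lambda>a. S h a - P h n a) \<le> q ^ n / (1 - q) * ell2_norm A h"
    if h: "h \<in> ell2_set A" for h n
  proof -
    have lim': "(\<lambda>m. P h (m + n) a - P h n a) \<longlonglongrightarrow> S h a - P h n a" for a n
      by (intro tendsto_intros LIMSEQ_ignore_initial_segment lim h)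
    have mem: "(\<lambda>a. P h (m + n) a - P h n a) \<in> ell2_set A" for m n
      by (intro ell2_diff Pset h)
    have limit: "(\<lambda>a. S h a - P h n a) \<in> ell2_set A"
      "ell2_norm A (\<lambda>a. S h a - P h n a) \<le> q ^ n / (1 - q) * ell2_norm A h" for n
      using ell2_limit[of "\<lambda>m a. P h (m + n) a - P h n a" A "q ^ n / (1 - q) * ell2_norm A h"
          "\<lambda>a. S h a - P h n a", OF mem tail[OF h] lim'] by blast+
    show "ell2_norm A (\<lambda>a. S h a - P h n a) \<le> q ^ n / (1 - q) * ell2_norm A h"
      by (rule limit(2))
    have "(\<lambda>a. S h a - P h 0 a) \<in> ell2_set A"
      by (rule limit(1))
    then show "S h \<in> ell2_set A" by (simp add: P_def)
  qed
  have S_norm: "ell2_norm A (S h) \<le> 1 / (1 - q) * ell2_norm A h" if "h \<in> ell2_set A" for h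
    using close(2)[OF that, of 0] by (simp add: P_def)
  have S_add: "S (\<lambda>a. f a + h a) = (\<lambda>a. S f a + S h a)" if "f \<in> ell2_set A" "h \<in> ell2_set A" for f h
    using Bn_add[OF that] suminf_add[OF summ[OF that(1)] summ[OF that(2)]] by (simp add: S_def)
  have S_scale: "S (\<lambda>a. k * f a) = (\<lambda>a. k * S f a)" if "f \<in> ell2_set A" for f k
    using Bn_scale[OF that] suminf_mult[OF summ[OF that]] by (simp add: S_def)
  \<comment> \<open>\<open>S\<close> inverts \<open>1 - B = c (T - z)\<close> on both sides.\<close>
  have S_left: "S (\<lambda>a. f a - B f a) = f" if f: "f \<in> ell2_set A" for f
  proof
    fix a
    have "(B ^^ i) (\<lambda>a. f a - B f a) = (\<lambda>a. (B ^^ i) f a - (B ^^ Suc i) f a)" for i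
      using Bn_add[OF f ell2_scale[OF Bset[OF f], of "-1"], of i] Bn_scale[OF Bset[OF f], of i "-1"]
      by (simp add: funpow_swap1)
    then have "P (\<lambda>a. f a - B f a) n a = f a - (B ^^ n) f a" for n
      using sum_lessThan_telescope'[of "\<lambda>i. (B ^^ i) f a" n] by (simp add: P_def)
    moreover have "(\<lambda>n. f a - (B ^^ n) f a) \<longlonglongrightarrow> f a - 0"
      by (intro tendsto_intros lim0 f)
    ultimately show "S (\<lambda>a. f a - B f a) a = f a"
      using lim[OF ell2_diff[OF f Bset[OF f]], of a] LIMSEQ_unique by fastforce
  qed
  have S_right: "(\<lambda>a. S h a - B (S h) a) = h" if h: "h \<in> ell2_set A" for h
  proof
    fix a
    have P_Suc: "P h (Suc n) = (\<lambda>a. h a + B (P h n) a)" for n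
    proof (induction n)
      case 0
      show ?case using B_scale[OF h, of 0] by (simp add: P_def)
    next
      case (Suc n)
      have "P h (Suc n) = (\<lambda>a. P h n a + (B ^^ n) h a)" by (simp add: P_def)
      then have "B (P h (Suc n)) = (\<lambda>a. B (P h n) a + (B ^^ Suc n) h a)"
        using B_add[OF Pset[OF h, of n] conjunct1[OF Bn[OF h, of n]]] by simp
      then show ?case using Suc by (simp add: P_def fun_eq_iff algebra_simps)
    qed
    have "(\<lambda>n. B (P h n) a) \<longlonglongrightarrow> B (S h) a"
    proof (rule Lim_transform2[OF tendsto_const])
      show "(\<lambda>n. B (S h) a - B (P h n) a) \<longlonglongrightarrow> 0"
      proof (rule tendsto_0_le[where K = 1, OF _ always_eventually])
        have "(\<lambda>n. q * (q ^ n / (1 - q) * ell2_norm A h)) \<longlonglongrightarrow> q * (0 / (1 - q) * ell2_norm A h)"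
          using q by (intro tendsto_intros LIMSEQ_power_zero) auto
        then show "(\<lambda>n. q * (q ^ n / (1 - q) * ell2_norm A h)) \<longlonglongrightarrow> 0" by simp
        show "\<forall>n. norm (B (S h) a - B (P h n) a) \<le> norm (q * (q ^ n / (1 - q) * ell2_norm A h)) * 1"
        proof
          fix n
          let ?d = "\<lambda>a. S h a - P h n a"
          have d: "?d \<in> ell2_set A" by (intro ell2_diff close Pset h)
          have "B ?d = (\<lambda>a. B (S h) a - B (P h n) a)"
            using B_add[OF close(1)[OF h] ell2_scale[OF Pset[OF h], of "-1"]] B_scale[OF Pset[OF h], of "-1"]
            by simp
          then have "norm (B (S h) a - B (P h n) a) \<le> ell2_norm A (B ?d)"
            using norm_le_ell2_norm[OF Bset[OF d], of a] by simp
          also have "\<dots> \<le> q * ell2_norm A ?d" by (rule B_norm[OF d])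
          also have "\<dots> \<le> q * (q ^ n / (1 - q) * ell2_norm A h)"
            using q by (intro mult_left_mono close h)
          finally show "norm (B (S h) a - B (P h n) a) \<le> norm (q * (q ^ n / (1 - q) * ell2_norm A h)) * 1"
            using q mult_nonneg_nonneg[OF q(1), of "q ^ n / (1 - q) * ell2_norm A h"]
            by (simp only: real_norm_def abs_of_nonneg mult_1_right)
        qed
      qed
    qed
    then have "(\<lambda>n. P h (Suc n) a) \<longlonglongrightarrow> h a + B (S h) a"
      unfolding P_Suc by (intro tendsto_intros)
    moreover have "(\<lambda>n. P h (Suc n) a) \<longlonglongrightarrow> S h a"
      using lim[OF h, of a] by (rule LIMSEQ_Suc)
    ultimately have "S h a = h a + B (S h) a" using LIMSEQ_unique by blast
    then show "S h a - B (S h) a = h a" by simp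
  qed
  define R where "R h = S (\<lambda>a. c * h a)" for h
  have "ell2_bounded_operator A R"
    unfolding ell2_bounded_operator_def
  proof (intro conjI ballI allI exI)
    fix f assume f: "f \<in> ell2_set A"
    note cf = ell2_scale[OF f, of c]
    show "R f \<in> ell2_set A" unfolding R_def by (rule close(1)[OF cf])
    show "ell2_norm A (R f) \<le> (1 / (1 - q) * cmod c) * ell2_norm A f"
      unfolding R_def using S_norm[OF cf] by (simp add: ell2_norm_scale)
    show "R (\<lambda>a. k * f a) = (\<lambda>a. k * R f a)" for k
      unfolding R_def using S_scale[OF cf, of k] by (simp add: ac_simps)
    fix h assume h: "h \<in> ell2_set A"
    show "R (\<lambda>a. f a + h a) = (\<lambda>a. R f a + R h a)"
      unfolding R_def using S_add[OF cf ell2_scale[OF h, of c]] by (simp add: distrib_left)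
  qed
  moreover have "R (\<lambda>a. T f a - z * f a) = f" if "f \<in> ell2_set A" for f
    using S_left[OF that] by (simp add: R_def B_def)
  moreover have "(\<lambda>a. T (R f) a - z * R f a) = f" if "f \<in> ell2_set A" for f
    using S_right[OF ell2_scale[OF that, of c]] c by (auto simp: R_def B_def fun_eq_iff)
  ultimately show ?thesis
    unfolding ell2_spectrum_def by blast
qed

section \<open>The spectrum of a self-adjoint contraction\<close>

lemma ell2_norm_square: "(ell2_norm A f)\<^sup>2 = (\<Sum>\<^sub>\<infinity>a\<in>A. (cmod (f a))\<^sup>2)"
  by (simp add: ell2_norm_def infsum_nonneg)

lemma ell2_square_summable: "f \<in> ell2_set A \<Longrightarrow> (\<lambda>a. (cmod (f a))\<^sup>2) summable_on A"
  by (simp add: ell2_set_def)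

lemma ell2_product_summable:
  assumes "f \<in> ell2_set A" "h \<in> ell2_set A"
  shows "(\<lambda>a. cnj (f a) * h a) summable_on A"
proof (rule abs_summable_summable, rule abs_summable_on_comparison_test)
  show "(\<lambda>a. (cmod (f a))\<^sup>2 + (cmod (h a))\<^sup>2) abs_summable_on A"
    using summable_on_add[OF ell2_square_summable[OF assms(1)] ell2_square_summable[OF assms(2)]]
    by simp
  show "norm (cnj (f a) * h a) \<le> norm ((cmod (f a))\<^sup>2 + (cmod (h a))\<^sup>2)" for a
  proof -
    have "0 \<le> cmod (f a) * cmod (h a)" by simp
    then show ?thesis
      using sum_squares_bound[of "cmod (f a)" "cmod (h a)"] unfolding norm_mult
      by (simp only: mult.assoc complex_mod_cnj real_norm_def)
  qed
qed

text \<open>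
The third assumption says that \<open>\<langle>f, T f\<rangle>\<close> is real. For \<open>z = a + i b\<close> with \<open>b \<noteq> 0\<close> put
\<open>h = (T - a) f\<close>. Then \<open>f - i e (T - z) f = (1 - e b) f - i e h\<close>, and since \<open>\<langle>f, h\<rangle>\<close> is real, the
square of its norm is \<open>(1 - e b)\<^sup>2 \<parallel>f\<parallel>\<^sup>2 + e\<^sup>2 \<parallel>h\<parallel>\<^sup>2\<close>, without a cross term. With
\<open>\<parallel>h\<parallel> \<le> K \<parallel>f\<parallel>\<close> this is a contraction for small \<open>e\<close> of the same sign as \<open>b\<close>. For real \<open>z\<close> with
\<open>\<bar>z\<bar> > 1\<close> the choice \<open>c = - 1 / z\<close> leaves the contraction \<open>T / z\<close>.
\<close>
lemma spectrum_symmetric_contraction: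
  assumes T: "ell2_bounded_operator A T"
    and le: "\<And>f. f \<in> ell2_set A \<Longrightarrow> ell2_norm A (T f) \<le> ell2_norm A f"
    and sym: "\<And>f. f \<in> ell2_set A \<Longrightarrow> (\<Sum>\<^sub>\<infinity>a\<in>A. Im (cnj (f a) * T f a)) = 0"
  shows "ell2_spectrum A T \<subseteq> complex_of_real ` {-1..1}"
proof
  fix z assume z: "z \<in> ell2_spectrum A T"
  note Tset = ell2_bounded_operatorD(1)[OF T]
  have "Im z = 0"
  proof (rule ccontr)
    assume b0: "Im z \<noteq> 0"
    define b where "b = Im z"
    define K where "K = 1 + \<bar>Re z\<bar>"
    \<comment> \<open>The value of \<open>e\<close> that minimises \<open>(1 - e b)\<^sup>2 + e\<^sup>2 K\<^sup>2\<close>; the minimum is \<open>q\<^sup>2\<close>.\<close>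
    define e where "e = b / (b\<^sup>2 + K\<^sup>2)"
    define q where "q = sqrt (K\<^sup>2 / (b\<^sup>2 + K\<^sup>2))"
    have b: "b \<noteq> 0" and K: "K > 0" and den: "b\<^sup>2 + K\<^sup>2 > 0"
      using b0 by (auto simp: b_def K_def sum_power2_gt_zero_iff)
    have e: "(1 - e * b)\<^sup>2 + e\<^sup>2 * K\<^sup>2 = q\<^sup>2" 
    proof -
      have "e * b + K\<^sup>2 / (b\<^sup>2 + K\<^sup>2) = 1"
        using less_imp_neq[OF den]
        by (simp only: e_def power2_eq_square times_divide_eq_left
            add_divide_distrib[symmetric] divide_self_if if_False simp_thms eq_commute)
      then have "1 - e * b = K\<^sup>2 / (b\<^sup>2 + K\<^sup>2)"
        by linarith
      then have "(1 - e * b)\<^sup>2 + e\<^sup>2 * K\<^sup>2 = ((K\<^sup>2)\<^sup>2 + b\<^sup>2 * K\<^sup>2) / (b\<^sup>2 + K\<^sup>2)\<^sup>2"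
        by (simp add: e_def power_divide add_divide_distrib)
      also have "(K\<^sup>2)\<^sup>2 + b\<^sup>2 * K\<^sup>2 = K\<^sup>2 * (b\<^sup>2 + K\<^sup>2)"
        by (simp add: power2_eq_square algebra_simps)
      also have "K\<^sup>2 * (b\<^sup>2 + K\<^sup>2) / (b\<^sup>2 + K\<^sup>2)\<^sup>2 = K\<^sup>2 / (b\<^sup>2 + K\<^sup>2)"
        using den by (simp add: power2_eq_square)
      also have "\<dots> = q\<^sup>2"
        by (simp add: q_def)
      finally show ?thesis .
    qed
    have "z \<notin> ell2_spectrum A T"
    proof (rule not_in_spectrum_if_contraction[OF T])
      show "\<i> * complex_of_real e \<noteq> 0"
        using b den by (simp add: e_def less_imp_neq[symmetric] del: of_real_divide)
      show "0 \<le> q" by (simp add: q_def)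
      show "q < 1"
        unfolding q_def using b den by simp
      fix f assume f: "f \<in> ell2_set A"
      define h where "h = (\<lambda>a. T f a - of_real (Re z) * f a)"
      have h: "h \<in> ell2_set A"
        unfolding h_def by (intro ell2_diff ell2_scale Tset f)
      have "h = (\<lambda>a. T f a + of_real (- Re z) * f a)"
        by (simp add: h_def)
      then have "ell2_norm A h \<le> ell2_norm A (T f) + ell2_norm A (\<lambda>a. of_real (- Re z) * f a)"
        using ell2_norm_triangle[OF Tset[OF f] ell2_scale[OF f]] by (simp only:)
      also have "\<dots> \<le> K * ell2_norm A f"
        unfolding ell2_norm_scale using le[OF f] by (simp add: K_def algebra_simps)
      finally have hK: "ell2_norm A h \<le> K * ell2_norm A f" .
      have pt: "(cmod (f a - \<i> * of_real e * (T f a - z * f a)))\<^sup>2 =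
          (1 - e * b)\<^sup>2 * (cmod (f a))\<^sup>2 + e\<^sup>2 * (cmod (h a))\<^sup>2 +
          2 * (1 - e * b) * e * Im (cnj (f a) * T f a)" for a
        unfolding cmod_power2 by (simp add: h_def b_def power2_eq_square algebra_simps)
      note s1 = summable_on_cmult_right[OF ell2_square_summable[OF f], of "(1 - e * b)\<^sup>2"]
      note s2 = summable_on_cmult_right[OF ell2_square_summable[OF h], of "e\<^sup>2"]
      have s3: "(\<lambda>a. 2 * (1 - e * b) * e * Im (cnj (f a) * T f a)) summable_on A"
        using ell2_product_summable[OF f Tset[OF f]] by (intro summable_on_cmult_right summable_on_Im)
      have "(ell2_norm A (\<lambda>a. f a - \<i> * of_real e * (T f a - z * f a)))\<^sup>2 =
          (1 - e * b)\<^sup>2 * (ell2_norm A f)\<^sup>2 + e\<^sup>2 * (ell2_norm A h)\<^sup>2"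
        unfolding ell2_norm_square pt
        by (simp only: infsum_add[OF summable_on_add[OF s1 s2] s3] infsum_add[OF s1 s2]
            infsum_cmult_right' sym[OF f])
      also have "\<dots> \<le> (1 - e * b)\<^sup>2 * (ell2_norm A f)\<^sup>2 + e\<^sup>2 * (K * ell2_norm A f)\<^sup>2"
        by (intro add_left_mono mult_left_mono power_mono hK) auto
      also have "\<dots> = ((1 - e * b)\<^sup>2 + e\<^sup>2 * K\<^sup>2) * (ell2_norm A f)\<^sup>2"
        by (simp add: algebra_simps power_mult_distrib)
      also have "\<dots> = (q * ell2_norm A f)\<^sup>2"
        by (simp add: e power_mult_distrib)
      finally show "ell2_norm A (\<lambda>a. f a - \<i> * of_real e * (T f a - z * f a)) \<le> q * ell2_norm A f"
        by (rule power2_le_imp_le) (simp add: q_def)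
    qed
    with z show False by simp
  qed
  then have zr: "z = of_real (Re z)"
    by (simp add: complex_eq_iff)
  have "\<bar>Re z\<bar> \<le> 1"
  proof (rule ccontr)
    assume big: "\<not> \<bar>Re z\<bar> \<le> 1"
    have "z \<notin> ell2_spectrum A T"
    proof (rule not_in_spectrum_if_contraction[OF T])
      show "- (1 / z) \<noteq> 0" "0 \<le> 1 / \<bar>Re z\<bar>" "1 / \<bar>Re z\<bar> < 1"
        using big by (auto simp: divide_simps)
      fix f assume f: "f \<in> ell2_set A"
      have "z \<noteq> 0" using big by auto
      then have "(\<lambda>a. f a - - (1 / z) * (T f a - z * f a)) = (\<lambda>a. 1 / z * T f a)"
        by (auto simp: fun_eq_iff algebra_simps)
      then have "ell2_norm A (\<lambda>a. f a - - (1 / z) * (T f a - z * f a)) = 1 / cmod z * ell2_norm A (T f)"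
        by (simp only: ell2_norm_scale norm_divide norm_one)
      also have "cmod z = \<bar>Re z\<bar>"
        by (subst zr) simp
      finally show "ell2_norm A (\<lambda>a. f a - - (1 / z) * (T f a - z * f a)) \<le> 1 / \<bar>Re z\<bar> * ell2_norm A f"
        using le[OF f] by (simp add: divide_right_mono)
    qed
    with z show False by simp
  qed
  with zr show "z \<in> complex_of_real ` {-1..1}"
    by (auto intro!: image_eqI[of _ _ "Re z"])
qed

lemma infsum_finite_sum:
  fixes F :: "'i \<Rightarrow> 'a \<Rightarrow> real"
  assumes "finite I" "\<And>i. i \<in> I \<Longrightarrow> F i summable_on A"
  shows "(\<Sum>\<^sub>\<infinity>a\<in>A. \<Sum>i\<in>I. F i a) = (\<Sum>i\<in>I. \<Sum>\<^sub>\<infinity>a\<in>A. F i a)"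
proof (rule infsumI)
  show "((\<lambda>a. \<Sum>i\<in>I. F i a) has_sum (\<Sum>i\<in>I. \<Sum>\<^sub>\<infinity>a\<in>A. F i a)) A"
    using assms by (induction rule: finite_induct) (auto intro!: has_sum_add)
qed

section \<open>The Markov operator of a symmetric set\<close>

text \<open>
The left regular representation, extended by \<open>0\<close> off the carrier.
\<close>
definition left_translate :: "('a, 'b) monoid_scheme \<Rightarrow> 'a \<Rightarrow> ('a \<Rightarrow> complex) \<Rightarrow> 'a \<Rightarrow> complex" where
  "left_translate G s f = (\<lambda>g. if g \<in> carrier G then f (inv\<^bsub>G\<^esub> s \<otimes>\<^bsub>G\<^esub> g) else 0)"

lemma markov_operator_translates:
  "markov_operator G S f = (\<lambda>g. 1 / of_nat (card S) * (\<Sum>s\<in>S. left_translate G s f g))"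
  by (auto simp: markov_operator_def left_translate_def fun_eq_iff)

context group
begin

lemma bij_betw_left_mult: "s \<in> carrier G \<Longrightarrow> bij_betw (\<lambda>g. s \<otimes> g) (carrier G) (carrier G)"
  by (simp add: bij_betw_def inj_on_cmult surj_const_mult)

lemma
  assumes "s \<in> carrier G" "f \<in> ell2_set (carrier G)"
  shows left_translate_ell2: "left_translate G s f \<in> ell2_set (carrier G)"
    and left_translate_norm: "ell2_norm (carrier G) (left_translate G s f) = ell2_norm (carrier G) f"
proof -
  have bij: "bij_betw (\<lambda>g. inv s \<otimes> g) (carrier G) (carrier G)"
    using assms by (intro bij_betw_left_mult) auto
  have "(\<lambda>g. (cmod (left_translate G s f g))\<^sup>2) summable_on carrier G \<longleftrightarrow>
    (\<lambda>g. (cmod (f (inv s \<otimes> g)))\<^sup>2) summable_on carrier G"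
    by (intro summable_on_cong) (simp add: left_translate_def)
  then show "left_translate G s f \<in> ell2_set (carrier G)"
    using assms summable_on_reindex_bij_betw[OF bij, of "\<lambda>g. (cmod (f g))\<^sup>2"]
    by (simp add: ell2_set_def left_translate_def)
  have "(\<Sum>\<^sub>\<infinity>g\<in>carrier G. (cmod (left_translate G s f g))\<^sup>2) = (\<Sum>\<^sub>\<infinity>g\<in>carrier G. (cmod (f (inv s \<otimes> g)))\<^sup>2)"
    by (intro infsum_cong) (simp add: left_translate_def)
  then show "ell2_norm (carrier G) (left_translate G s f) = ell2_norm (carrier G) f"
    using infsum_reindex_bij_betw[OF bij, of "\<lambda>g. (cmod (f g))\<^sup>2"] by (simp add: ell2_norm_def)
qed

lemma
  assumes S: "finite S" "S \<subseteq> carrier G"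
  shows markov_operator_bounded: "ell2_bounded_operator (carrier G) (markov_operator G S)"
    and markov_operator_norm_le: "f \<in> ell2_set (carrier G) \<Longrightarrow>
      ell2_norm (carrier G) (markov_operator G S f) \<le> ell2_norm (carrier G) f"
proof -
  let ?M = "markov_operator G S" and ?A = "carrier G"
  have tr: "left_translate G s f \<in> ell2_set ?A"
    "ell2_norm ?A (left_translate G s f) = ell2_norm ?A f"
    if "s \<in> S" "f \<in> ell2_set ?A" for s f
    using left_translate_ell2 left_translate_norm S that by auto
  have set: "?M f \<in> ell2_set ?A" if "f \<in> ell2_set ?A" for f
    unfolding markov_operator_translates by (intro ell2_scale ell2_sum S tr that)
  have norm: "ell2_norm ?A (?M f) \<le> ell2_norm ?A f" if f: "f \<in> ell2_set ?A" for f
  proof -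
    have "ell2_norm ?A (\<lambda>g. \<Sum>s\<in>S. left_translate G s f g) \<le> (\<Sum>s\<in>S. ell2_norm ?A (left_translate G s f))"
      by (intro ell2_norm_sum S tr f)
    also have "\<dots> = real (card S) * ell2_norm ?A f"
      using tr(2)[OF _ f] by simp
    finally show ?thesis
      unfolding markov_operator_translates ell2_norm_scale
      by (cases "card S = 0") (simp_all add: norm_divide divide_simps mult.commute)
  qed
  then show "f \<in> ell2_set ?A \<Longrightarrow> ell2_norm ?A (?M f) \<le> ell2_norm ?A f" .
  have "?M (\<lambda>a. f a + h a) = (\<lambda>a. ?M f a + ?M h a)" for f h
    by (auto simp: markov_operator_def sum.distrib distrib_left)
  moreover have "?M (\<lambda>a. c * f a) = (\<lambda>a. c * ?M f a)" for c f
    by (auto simp: markov_operator_def sum_distrib_left algebra_simps)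
  ultimately show "ell2_bounded_operator ?A ?M"
    unfolding ell2_bounded_operator_def using set norm
    by (intro conjI exI[of _ 1]) auto
qed

text \<open>
Replacing \<open>s\<close> by its inverse conjugates \<open>\<langle>f, \<lambda>(s) f\<rangle>\<close>, so the imaginary parts cancel in the sum over
a symmetric set.
\<close>
lemma markov_operator_symmetric:
  assumes S: "finite S" "S \<subseteq> carrier G" and inv: "(\<lambda>s. inv s) ` S = S"
    and f: "f \<in> ell2_set (carrier G)"
  shows "(\<Sum>\<^sub>\<infinity>g\<in>carrier G. Im (cnj (f g) * markov_operator G S f g)) = 0"
proof -
  define B where "B s = (\<Sum>\<^sub>\<infinity>g\<in>carrier G. Im (cnj (f g) * left_translate G s f g))" for s
  have summ: "(\<lambda>g. Im (cnj (f g) * left_translate G s f g)) summable_on carrier G" if "s \<in> S" for s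
    using ell2_product_summable[OF f left_translate_ell2[OF _ f]] S that by (intro summable_on_Im) auto
  have neg: "B (inv s) = - B s" if s: "s \<in> S" for s
  proof -
    have sc: "s \<in> carrier G" using s S by auto
    have bij: "bij_betw (\<lambda>g. inv s \<otimes> g) (carrier G) (carrier G)"
      using sc by (intro bij_betw_left_mult) auto
    have "B (inv s) = (\<Sum>\<^sub>\<infinity>g\<in>carrier G. Im (cnj (f (inv s \<otimes> g)) * left_translate G (inv s) f (inv s \<otimes> g)))"
      unfolding B_def by (rule infsum_reindex_bij_betw[OF bij, symmetric])
    also have "\<dots> = (\<Sum>\<^sub>\<infinity>g\<in>carrier G. - Im (cnj (f g) * left_translate G s f g))"
      using sc by (intro infsum_cong) (simp add: left_translate_def m_assoc[symmetric])
    also have "\<dots> = - B s"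
      unfolding B_def by (rule infsum_uminus)
    finally show ?thesis .
  qed
  have "inj_on (\<lambda>s. inv s) S"
    using S inv_inj inj_on_subset by blast
  then have "(\<Sum>s\<in>S. B s) = (\<Sum>s\<in>S. B (inv s))"
    using sum.reindex[of "\<lambda>s. inv s" S B] inv by simp
  then have 0: "(\<Sum>s\<in>S. B s) = 0"
    using neg by (simp add: sum_negf)
  have "(\<Sum>\<^sub>\<infinity>g\<in>carrier G. Im (cnj (f g) * markov_operator G S f g)) =
    (\<Sum>\<^sub>\<infinity>g\<in>carrier G. 1 / real (card S) * (\<Sum>s\<in>S. Im (cnj (f g) * left_translate G s f g)))"
  proof (rule infsum_cong)
    fix g
    have "cnj (f g) * markov_operator G S f g =
      of_real (1 / real (card S)) * (\<Sum>s\<in>S. cnj (f g) * left_translate G s f g)"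
      by (simp add: markov_operator_translates sum_distrib_left algebra_simps)
    moreover have "Im (of_real r * w) = r * Im w" for r w
      by simp
    ultimately show "Im (cnj (f g) * markov_operator G S f g) =
      1 / real (card S) * (\<Sum>s\<in>S. Im (cnj (f g) * left_translate G s f g))"
      by (simp only: Im_sum)
  qed
  also have "\<dots> = 1 / real (card S) * (\<Sum>s\<in>S. B s)"
    unfolding infsum_cmult_right' B_def using infsum_finite_sum[OF S(1) summ] by simp
  finally show ?thesis using 0 by simp
qed

lemma group_spectrum_subset:
  assumes "finite S" "S \<subseteq> carrier G" "(\<lambda>s. inv s) ` S = S"
  shows "group_spectrum G S \<subseteq> complex_of_real ` {-1..1}"
  unfolding group_spectrum_def
  using assms by (intro spectrum_symmetric_contraction markov_operator_bounded
      markov_operator_norm_le markov_operator_symmetric)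

end

section \<open>Foelner sets and approximate eigenvectors\<close>

text \<open>
Amenability, as witnessed on \<open>S\<close>. Since \<open>s F\<close> and \<open>F\<close> have the same size, controlling
\<open>s F - F\<close> controls the symmetric difference.
\<close>
definition foelner :: "('a, 'b) monoid_scheme \<Rightarrow> 'a set \<Rightarrow> bool" where
  "foelner G S \<longleftrightarrow> (\<forall>e>0. \<exists>F. finite F \<and> F \<noteq> {} \<and> F \<subseteq> carrier G \<and>
     (\<forall>s\<in>S. real (card ((\<lambda>g. s \<otimes>\<^bsub>G\<^esub> g) ` F - F)) \<le> e * real (card F)))"

lemma
  assumes "finite D" "D \<subseteq> A" "\<And>a. a \<notin> D \<Longrightarrow> f a = 0"
  shows finite_support_ell2: "f \<in> ell2_set A"
    and finite_support_norm: "(ell2_norm A f)\<^sup>2 = (\<Sum>a\<in>D. (cmod (f a))\<^sup>2)"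
proof -
  have "(\<lambda>a. (cmod (f a))\<^sup>2) summable_on A \<longleftrightarrow> (\<lambda>a. (cmod (f a))\<^sup>2) summable_on D"
    using assms by (intro summable_on_cong_neutral) auto
  then show "f \<in> ell2_set A"
    using assms by (auto simp: ell2_set_def)
  have "(\<Sum>\<^sub>\<infinity>a\<in>A. (cmod (f a))\<^sup>2) = (\<Sum>\<^sub>\<infinity>a\<in>D. (cmod (f a))\<^sup>2)"
    using assms by (intro infsum_cong_neutral) auto
  then show "(ell2_norm A f)\<^sup>2 = (\<Sum>a\<in>D. (cmod (f a))\<^sup>2)"
    using assms by (simp add: ell2_norm_square)
qed

context group
begin

text \<open>
Multiplication by the inverse of \<open>s\<close> maps \<open>F - s F\<close> onto the set on the left, and \<open>F - s F\<close>
has as many elements as \<open>s F - F\<close>.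
\<close>
lemma card_left_translate_diff_inv:
  assumes "finite F" "F \<subseteq> carrier G" "s \<in> carrier G"
  shows "card ((\<lambda>g. inv s \<otimes> g) ` F - F) = card ((\<lambda>g. s \<otimes> g) ` F - F)"
proof -
  let ?sF = "(\<lambda>g. s \<otimes> g) ` F"
  have inj: "inj_on (\<lambda>g. t \<otimes> g) H" if "t \<in> carrier G" "H \<subseteq> carrier G" for t H
    using inj_on_cmult[OF that(1)] that(2) inj_on_subset by blast
  have "F = (\<lambda>g. inv s \<otimes> g) ` ?sF"
    using assms by (force simp: image_image m_assoc[symmetric])
  then have "(\<lambda>g. inv s \<otimes> g) ` F - F = (\<lambda>g. inv s \<otimes> g) ` (F - ?sF)"
    using inj_on_image_set_diff[OF inj[of "inv s" "carrier G"], of F ?sF] assms by auto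
  then have "card ((\<lambda>g. inv s \<otimes> g) ` F - F) = card (F - ?sF)"
    using assms by (simp add: card_image inj subset_iff)
  moreover have "card ?sF = card F"
    using assms by (simp add: card_image inj)
  ultimately show ?thesis
    using assms by (simp add: card_Diff_subset_Int Int_commute)
qed

text \<open>
On the intersection of \<open>F\<close> and \<open>s F\<close>, and outside both, translation by \<open>s\<close> acts on the twisted
indicator as multiplication by the inverse character value of \<open>s\<close>. The error therefore lives on
the symmetric difference, where it has absolute value at most \<open>1\<close>.
\<close>
lemma twisted_indicator_translate_norm:
  fixes \<phi> :: "'a \<Rightarrow> int"
  assumes hom: "\<And>g h. g \<in> carrier G \<Longrightarrow> h \<in> carrier G \<Longrightarrow> \<phi> (g \<otimes> h) = \<phi> g + \<phi> h"
    and F: "finite F" "F \<subseteq> carrier G" and s: "s \<in> carrier G"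
    and f: "f = (\<lambda>g. if g \<in> F then cis (\<theta> * of_int (\<phi> g)) else 0)"
  shows "(ell2_norm (carrier G) (\<lambda>g. left_translate G s f g - cis (- \<theta> * of_int (\<phi> s)) * f g))\<^sup>2
    \<le> 2 * real (card ((\<lambda>g. s \<otimes> g) ` F - F))"
proof -
  let ?sF = "(\<lambda>g. s \<otimes> g) ` F" and ?d = "\<lambda>g. left_translate G s f g - cis (- \<theta> * of_int (\<phi> s)) * f g"
  have inj: "inj_on (\<lambda>g. s \<otimes> g) F"
    using inj_on_cmult[OF s] F inj_on_subset by blast
  have sF: "?sF \<subseteq> carrier G" using F s by auto
  have mem: "inv s \<otimes> g \<in> F \<longleftrightarrow> g \<in> ?sF" if "g \<in> carrier G" for g
    using F s that by (force simp: image_iff m_assoc[symmetric])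
  have val: "\<phi> (inv s \<otimes> g) = \<phi> g - \<phi> s" if g: "g \<in> carrier G" for g
  proof -
    have "\<phi> g = \<phi> (s \<otimes> (inv s \<otimes> g))"
      using g s by (simp add: m_assoc[symmetric])
    then show ?thesis using hom[of s "inv s \<otimes> g"] g s by simp
  qed
  have out: "?d g = 0" if "g \<notin> (?sF - F) \<union> (F - ?sF)" for g
  proof (cases "g \<in> F")
    case True
    then have g: "g \<in> carrier G" "g \<in> ?sF" using that F by auto
    have "cis (- \<theta> * of_int (\<phi> s)) * cis (\<theta> * of_int (\<phi> g)) = cis (\<theta> * of_int (\<phi> g - \<phi> s))"
      by (simp add: cis_mult algebra_simps)
    then show ?thesis
      using True g by (simp add: left_translate_def f mem val)
  next
    case False
    then have "g \<notin> ?sF" using that by auto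
    then show ?thesis
      using False by (simp add: left_translate_def f mem)
  qed
  have le: "cmod (?d g) \<le> 1" if "g \<in> (?sF - F) \<union> (F - ?sF)" for g
    using that F sF by (auto simp: left_translate_def f mem norm_mult)
  have "(ell2_norm (carrier G) ?d)\<^sup>2 = (\<Sum>g\<in>(?sF - F) \<union> (F - ?sF). (cmod (?d g))\<^sup>2)"
    using F sF by (intro finite_support_norm out) auto
  also have "\<dots> \<le> (\<Sum>g\<in>(?sF - F) \<union> (F - ?sF). 1)"
    using le by (intro sum_mono) (simp add: power_le_one)
  also have "\<dots> = real (card (?sF - F)) + real (card (F - ?sF))"
    using F by (subst sum.union_disjoint) auto
  also have "card (F - ?sF) = card (?sF - F)"
    using F inj by (simp add: card_Diff_subset_Int Int_commute card_image)
  finally show ?thesis by simp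
qed

text \<open>
The four character values \<open>exp (\<plusminus> i \<theta>)\<close> at \<open>x\<close>, \<open>y\<close> and their inverses average to \<open>cos \<theta>\<close>, so a
twisted Foelner indicator is an approximate eigenvector for \<open>cos \<theta>\<close>.
\<close>
lemma cos_in_group_spectrum:
  fixes \<phi> :: "'a \<Rightarrow> int"
  assumes xy: "x \<in> carrier G" "y \<in> carrier G" "x \<noteq> y"
    and hom: "\<And>g h. g \<in> carrier G \<Longrightarrow> h \<in> carrier G \<Longrightarrow> \<phi> (g \<otimes> h) = \<phi> g + \<phi> h"
    and one: "\<phi> x = 1" "\<phi> y = 1"
    and fol: "foelner G {x, y}"
  shows "complex_of_real (cos \<theta>) \<in> group_spectrum G {x, inv x, y, inv y}"
proof -
  define S where "S = {x, inv x, y, inv y}"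
  let ?A = "carrier G"
  have S: "finite S" "S \<subseteq> carrier G" using xy by (auto simp: S_def)
  have "\<phi> \<one> = 0" using hom[of \<one> \<one>] by simp
  then have inv: "\<phi> (inv x) = -1" "\<phi> (inv y) = -1"
    using hom[of x "inv x"] hom[of y "inv y"] xy one by auto
  have "inv x \<noteq> inv y" using xy inv_inj by (auto dest: inj_onD)
  moreover have "x \<noteq> inv x" "x \<noteq> inv y" "y \<noteq> inv x" "y \<noteq> inv y"
    using one inv by force+
  ultimately have sumS: "(\<Sum>s\<in>S. F s) = F x + F (inv x) + F y + F (inv y)"
    and card: "card S = 4" for F :: "'a \<Rightarrow> complex"
    unfolding S_def using xy(3) by (auto simp: add.assoc)
  have "of_real (cos \<theta>) \<in> ell2_spectrum ?A (markov_operator G S)"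
  proof (rule approximate_eigenvalue_in_spectrum[OF markov_operator_bounded[OF S]])
    fix e :: real assume e: "0 < e"
    obtain F where F: "finite F" "F \<noteq> {}" "F \<subseteq> ?A"
      and small: "\<And>s. s \<in> {x, y} \<Longrightarrow> real (card ((\<lambda>g. s \<otimes> g) ` F - F)) \<le> e\<^sup>2 / 2 * real (card F)"
      using fol[unfolded foelner_def, rule_format, of "e\<^sup>2 / 2"] e by auto
    define f where "f = (\<lambda>g. if g \<in> F then cis (\<theta> * of_int (\<phi> g)) else 0)"
    have f: "f \<in> ell2_set ?A"
      using F by (intro finite_support_ell2[of F]) (auto simp: f_def)
    have "(ell2_norm ?A f)\<^sup>2 = (\<Sum>g\<in>F. (cmod (f g))\<^sup>2)"
      using F by (intro finite_support_norm) (auto simp: f_def)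
    then have norm_f: "(ell2_norm ?A f)\<^sup>2 = real (card F)"
      by (simp add: f_def)
    have "real (card F) > 0" using F by (simp add: card_gt_0_iff)
    then have pos: "0 < ell2_norm ?A f"
      using norm_f by (metis ell2_norm_nonneg less_eq_real_def less_numeral_extra(3) zero_power2)
    define d where "d s = (\<lambda>g. left_translate G s f g - cis (- \<theta> * of_int (\<phi> s)) * f g)" for s
    have d_set: "d s \<in> ell2_set ?A" if "s \<in> S" for s
      unfolding d_def using that S f by (intro ell2_diff ell2_scale left_translate_ell2) auto
    have d_norm: "ell2_norm ?A (d s) \<le> e * ell2_norm ?A f" if "s \<in> S" for s
    proof (rule power2_le_imp_le)
      have "real (card ((\<lambda>g. s \<otimes> g) ` F - F)) \<le> e\<^sup>2 / 2 * real (card F)"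
        using that small[of x] small[of y] card_left_translate_diff_inv[OF F(1,3)] xy
        by (auto simp: S_def)
      moreover have "(ell2_norm ?A (d s))\<^sup>2 \<le> 2 * real (card ((\<lambda>g. s \<otimes> g) ` F - F))"
        unfolding d_def using hom F S that
        by (intro twisted_indicator_translate_norm[of \<phi>]) (auto simp: f_def)
      ultimately show "(ell2_norm ?A (d s))\<^sup>2 \<le> (e * ell2_norm ?A f)\<^sup>2"
        by (simp add: power_mult_distrib norm_f)
    qed (use e in auto)
    have "(\<lambda>g. markov_operator G S f g - of_real (cos \<theta>) * f g) = (\<lambda>g. 1 / 4 * (\<Sum>s\<in>S. d s g))"
    proof
      fix g
      have "(\<Sum>s\<in>S. cis (- \<theta> * of_int (\<phi> s))) = 4 * of_real (cos \<theta>)"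
        by (simp add: sumS one inv complex_eq_iff)
      then have "(\<Sum>s\<in>S. d s g) = (\<Sum>s\<in>S. left_translate G s f g) - 4 * of_real (cos \<theta>) * f g"
        unfolding d_def by (simp add: sum_subtractf sum_distrib_right[symmetric])
      then show "markov_operator G S f g - of_real (cos \<theta>) * f g = 1 / 4 * (\<Sum>s\<in>S. d s g)"
        by (simp add: markov_operator_translates card)
    qed
    then have "ell2_norm ?A (\<lambda>g. markov_operator G S f g - of_real (cos \<theta>) * f g)
      = 1 / 4 * ell2_norm ?A (\<lambda>g. \<Sum>s\<in>S. d s g)"
      by (simp only: ell2_norm_scale) simp
    also have "ell2_norm ?A (\<lambda>g. \<Sum>s\<in>S. d s g) \<le> (\<Sum>s\<in>S. ell2_norm ?A (d s))"
      by (intro ell2_norm_sum S d_set)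
    also have "\<dots> \<le> (\<Sum>s\<in>S. e * ell2_norm ?A f)"
      by (intro sum_mono d_norm)
    also have "1 / 4 * \<dots> = e * ell2_norm ?A f"
      by (simp add: card)
    finally show "\<exists>f\<in>ell2_set ?A. 0 < ell2_norm ?A f \<and>
      ell2_norm ?A (\<lambda>g. markov_operator G S f g - of_real (cos \<theta>) * f g) \<le> e * ell2_norm ?A f"
      using f pos by auto
  qed
  then show ?thesis by (simp add: group_spectrum_def S_def)
qed

theorem group_spectrum_eq_interval:
  fixes \<phi> :: "'a \<Rightarrow> int"
  assumes xy: "x \<in> carrier G" "y \<in> carrier G" "x \<noteq> y"
    and hom: "\<And>g h. g \<in> carrier G \<Longrightarrow> h \<in> carrier G \<Longrightarrow> \<phi> (g \<otimes> h) = \<phi> g + \<phi> h"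
    and one: "\<phi> x = 1" "\<phi> y = 1"
    and fol: "foelner G {x, y}"
  shows "group_spectrum G {x, inv x, y, inv y} = complex_of_real ` {-1..1}"
proof
  show "group_spectrum G {x, inv x, y, inv y} \<subseteq> complex_of_real ` {-1..1}"
    using xy by (intro group_spectrum_subset) auto
  show "complex_of_real ` {-1..1} \<subseteq> group_spectrum G {x, inv x, y, inv y}"
  proof
    fix z assume "z \<in> complex_of_real ` {-1..1}"
    then obtain t where "-1 \<le> t" "t \<le> 1" "z = of_real t" by auto
    then show "z \<in> group_spectrum G {x, inv x, y, inv y}"
      using cos_in_group_spectrum[OF assms, of "arccos t"] by simp
  qed
qed

end

section \<open>Commutators\<close>

context group
begin

text \<open>
The equation \<open>k (h g) = g h\<close> characterises the commutator of \<open>g\<close> and \<open>h\<close> without inverses, which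
makes it easy to compare coordinates in a concrete group.
\<close>
lemma commutatorE:
  assumes "g \<in> carrier G" "h \<in> carrier G"
  obtains k where "g \<otimes> h \<otimes> inv g \<otimes> inv h = k" "k \<in> carrier G" "k \<otimes> (h \<otimes> g) = g \<otimes> h"
proof
  show "g \<otimes> h \<otimes> inv g \<otimes> inv h \<otimes> (h \<otimes> g) = g \<otimes> h"
  proof -
    have "inv g \<otimes> inv h \<otimes> (h \<otimes> g) = \<one>"
      using assms by (metis inv_mult_group l_inv m_closed)
    then show ?thesis
      using assms by (simp add: m_assoc)
  qed
qed (use assms in auto)

lemma derived_subset:
  assumes "K \<subseteq> carrier G" "subgroup L G"
    and "\<And>g h k. g \<in> K \<Longrightarrow> h \<in> K \<Longrightarrow> k \<in> carrier G \<Longrightarrow> k \<otimes> (h \<otimes> g) = g \<otimes> h \<Longrightarrow> k \<in> L"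
  shows "derived G K \<subseteq> L"
  unfolding derived_def
proof (rule generate_subgroup_incl[OF _ assms(2)])
  show "derived_set G K \<subseteq> L"
  proof
    fix k assume "k \<in> derived_set G K"
    then obtain g h where gh: "g \<in> K" "h \<in> K" and k: "k = g \<otimes> h \<otimes> inv g \<otimes> inv h"
      by blast
    then have gh': "g \<in> carrier G" "h \<in> carrier G" using assms(1) by auto
    obtain k' where "k = k'" "k' \<in> carrier G" "k' \<otimes> (h \<otimes> g) = g \<otimes> h"
      using k by (rule_tac commutatorE[OF gh']) simp
    then show "k \<in> L" using assms(3)[OF gh] by simp
  qed
qed

lemma mem_derived:
  assumes "K \<subseteq> carrier G" "g \<in> K" "h \<in> K" "k \<in> carrier G" "k \<otimes> (h \<otimes> g) = g \<otimes> h"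
  shows "k \<in> derived G K"
proof -
  have gh: "g \<in> carrier G" "h \<in> carrier G" using assms by auto
  obtain k' where k': "g \<otimes> h \<otimes> inv g \<otimes> inv h = k'" "k' \<in> carrier G"
    "k' \<otimes> (h \<otimes> g) = g \<otimes> h"
    by (rule commutatorE[OF gh])
  have "k = k'"
    using assms(4,5) k'(2,3) gh by (metis m_closed right_cancel)
  then have "k \<in> derived_set G K"
    using k'(1) assms(2,3) by blast
  then show ?thesis
    unfolding derived_def by (rule generate.incl)
qed

end

section \<open>A shift-invariant bilinear form\<close>

(* basis 0 would otherwise be rewritten to 1 and escape the rules for basis. *)
declare single_one [simp del]

text \<open>
The bilinear form on \<open>\<Oplus>\<int>\<close> with value \<open>b (j - i)\<close> on the \<open>i\<close>-th and the \<open>j\<close>-th basis vector. It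
depends on \<open>j - i\<close> only, so it is invariant under shifts.
\<close>
definition bilin :: "(int \<Rightarrow> rat) \<Rightarrow> (int \<Rightarrow>\<^sub>0 int) \<Rightarrow> (int \<Rightarrow>\<^sub>0 int) \<Rightarrow> rat" where
  "bilin b u v = (\<Sum>i\<in>Poly_Mapping.keys u. \<Sum>j\<in>Poly_Mapping.keys v.
     of_int (poly_mapping.lookup u i * poly_mapping.lookup v j) * b (j - i))"

text \<open>
Bilinearity follows once two arguments are expanded over a common finite index set.
\<close>
lemma bilin_superset:
  assumes "finite I" "finite J" "Poly_Mapping.keys u \<subseteq> I" "Poly_Mapping.keys v \<subseteq> J"
  shows "bilin b u v = (\<Sum>i\<in>I. \<Sum>j\<in>J. of_int (poly_mapping.lookup u i * poly_mapping.lookup v j) * b (j - i))"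
proof -
  have "(\<Sum>j\<in>Poly_Mapping.keys v. of_int (poly_mapping.lookup u i * poly_mapping.lookup v j) * b (j - i)) =
    (\<Sum>j\<in>J. of_int (poly_mapping.lookup u i * poly_mapping.lookup v j) * b (j - i))" for i
    using assms by (intro sum.mono_neutral_left) (auto simp: in_keys_iff)
  then show ?thesis
    unfolding bilin_def using assms by (intro sum.mono_neutral_cong_left) (auto simp: in_keys_iff)
qed

lemma bilin_add_left: "bilin b (u + u') v = bilin b u v + bilin b u' v"
proof -
  define I where "I = Poly_Mapping.keys u \<union> Poly_Mapping.keys u'"
  have "Poly_Mapping.keys (u + u') \<subseteq> I" by (simp add: I_def keys_add)
  then show ?thesis
    using bilin_superset[of I "Poly_Mapping.keys v"]
    by (simp add: I_def lookup_add distrib_right sum.distrib)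
qed

lemma bilin_add_right: "bilin b u (v + v') = bilin b u v + bilin b u v'"
proof -
  define I where "I = Poly_Mapping.keys v \<union> Poly_Mapping.keys v'"
  have "Poly_Mapping.keys (v + v') \<subseteq> I" by (simp add: I_def keys_add)
  then show ?thesis
    using bilin_superset[of "Poly_Mapping.keys u" I]
    by (simp add: I_def lookup_add distrib_right distrib_left sum.distrib)
qed

lemma bilin_zero [simp]: "bilin b 0 v = 0" "bilin b u 0 = 0"
  by (simp_all add: bilin_def)

lemma bilin_minus_left: "bilin b (- u) v = - bilin b u v"
  using bilin_add_left[of b u "- u" v] by simp

lemma bilin_minus_right: "bilin b u (- v) = - bilin b u v"
  using bilin_add_right[of b u v "- v"] by simp

lemma bilin_diff_left: "bilin b (u - u') v = bilin b u v - bilin b u' v"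
  using bilin_add_left[of b u "- u'" v] by (simp add: bilin_minus_left)

lemma bilin_diff_right: "bilin b u (v - v') = bilin b u v - bilin b u v'"
  using bilin_add_right[of b u v "- v'"] by (simp add: bilin_minus_right)

abbreviation basis :: "int \<Rightarrow> (int \<Rightarrow>\<^sub>0 int)" where
  "basis i \<equiv> Poly_Mapping.single i 1"

lemma bilin_basis_left:
  "bilin b (basis i) v = (\<Sum>j\<in>Poly_Mapping.keys v. of_int (poly_mapping.lookup v j) * b (j - i))"
  by (simp add: bilin_def)

lemma bilin_basis [simp]: "bilin b (basis i) (basis j) = b (j - i)"
  by (simp add: bilin_def)

definition shift :: "int \<Rightarrow> (int \<Rightarrow>\<^sub>0 int) \<Rightarrow> (int \<Rightarrow>\<^sub>0 int)" where
  "shift n = Poly_Mapping.map_key (\<lambda>i. i + n)"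

lemma lookup_shift [simp]: "poly_mapping.lookup (shift n u) i = poly_mapping.lookup u (i + n)"
  by (simp add: shift_def map_key.rep_eq)

lemma shift_simps [simp]:
  "shift n (u + v) = shift n u + shift n v" "shift n 0 = 0" "shift n (- u) = - shift n u"
  "shift n (u - v) = shift n u - shift n v"
  "shift m (shift n u) = shift (m + n) u" "shift 0 u = u" "shift n (basis i) = basis (i - n)"
  by (rule poly_mapping_eqI, simp add: lookup_add lookup_minus lookup_single when_def algebra_simps)+

lemma bilin_shift [simp]: "bilin b (shift n u) (shift n v) = bilin b u v"
proof -
  have keys: "Poly_Mapping.keys (shift n w) = (\<lambda>i. i - n) ` Poly_Mapping.keys w" for w
    by (force simp: in_keys_iff image_iff)
  have inj: "inj_on (\<lambda>i. i - n) X" for X :: "int set"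
    by (simp add: inj_on_def)
  show ?thesis
    unfolding bilin_def keys by (simp add: sum.reindex[OF inj])
qed

section \<open>The group\<close>

type_synonym hall_elt = "int \<times> (int \<Rightarrow>\<^sub>0 int) \<times> rat"

text \<open>
The triple \<open>(n, u, c)\<close> stands for \<open>t\<^sup>n (u, c)\<close>, where \<open>(u, c)\<close> lies in the extension of \<open>\<Oplus>\<int>\<close> by
the central subgroup \<open>C\<close> with cocycle \<open>bilin b\<close>, and \<open>t\<close> acts on that extension by shifts. With the
power of \<open>t\<close> on the left, left multiplication by \<open>t\<close> changes only \<open>n\<close>; this keeps the Foelner sets
simple.
\<close>
definition hall_group :: "rat set \<Rightarrow> (int \<Rightarrow> rat) \<Rightarrow> hall_elt monoid" where
  "hall_group C b = \<lparr>carrier = UNIV \<times> UNIV \<times> C,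
     mult = (\<lambda>(n, u, c) (m, v, d). (n + m, shift m u + v, c + d + bilin b (shift m u) v)),
     one = (0, 0, 0)\<rparr>"

text \<open>
The commutator of \<open>a\<^sub>0\<close> and \<open>a\<^sub>k\<close> is \<open>b k - b (- k)\<close>. Letting \<open>b\<close> vanish on nonpositive
arguments makes it \<open>b k\<close> for \<open>k \<ge> 1\<close>, so that these commutators exhaust \<open>C\<close> and two elements
generate the group. Nontriviality of \<open>C\<close> forces derived length three, and local cyclicity gives
Foelner sets inside \<open>C\<close>.
\<close>
locale hall_data =
  fixes C :: "rat set" and b :: "int \<Rightarrow> rat"
  assumes zero_mem: "0 \<in> C"
    and add_mem: "c \<in> C \<Longrightarrow> d \<in> C \<Longrightarrow> c + d \<in> C"
    and uminus_mem: "c \<in> C \<Longrightarrow> - c \<in> C"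
    and b_nonpos: "k \<le> 0 \<Longrightarrow> b k = 0"
    and b_range: "b ` {1..} = C"
    and nontrivial: "C \<noteq> {0}"
    and locally_cyclic: "finite X \<Longrightarrow> X \<subseteq> C \<Longrightarrow>
      \<exists>e\<in>C. 0 < e \<and> (\<forall>c\<in>X. \<exists>k. c = of_int k * e)"
begin

abbreviation H :: "hall_elt monoid" where "H \<equiv> hall_group C b"

lemma b_mem: "b k \<in> C"
  using b_nonpos[of k] b_range zero_mem by (cases "k \<le> 0") auto

lemma of_int_mult_mem:
  assumes "c \<in> C" shows "of_int k * c \<in> C"
proof (induction k rule: int_induct[where k = 0])
  case base
  then show ?case by (simp add: zero_mem)
next
  case (step1 i)
  then show ?case using add_mem[OF _ assms] by (simp add: distrib_right)
next
  case (step2 i)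
  then show ?case using add_mem[OF _ uminus_mem[OF assms]] by (force simp: left_diff_distrib)
qed

lemma sum_mem: "(\<And>i. i \<in> I \<Longrightarrow> f i \<in> C) \<Longrightarrow> sum f I \<in> C"
  by (induction I rule: infinite_finite_induct) (auto simp: zero_mem add_mem)

lemma bilin_mem: "bilin b u v \<in> C"
  unfolding bilin_def by (intro sum_mem of_int_mult_mem b_mem)

lemma hall_simps [simp]:
  "(n, u, c) \<in> carrier H \<longleftrightarrow> c \<in> C"
  "(n, u, c) \<otimes>\<^bsub>H\<^esub> (m, v, d) = (n + m, shift m u + v, c + d + bilin b (shift m u) v)"
  "\<one>\<^bsub>H\<^esub> = (0, 0, 0)"
  by (simp_all add: hall_group_def)

lemma hall_mult_eq:
  "g \<otimes>\<^bsub>H\<^esub> h = (fst g + fst h, shift (fst h) (fst (snd g)) + fst (snd h),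
     snd (snd g) + snd (snd h) + bilin b (shift (fst h) (fst (snd g))) (fst (snd h)))"
  by (cases g, cases h) simp

lemma hall_components:
  "fst (g \<otimes>\<^bsub>H\<^esub> h) = fst g + fst h"
  "fst (snd (g \<otimes>\<^bsub>H\<^esub> h)) = shift (fst h) (fst (snd g)) + fst (snd h)"
  "snd (snd (g \<otimes>\<^bsub>H\<^esub> h)) = snd (snd g) + snd (snd h) + bilin b (shift (fst h) (fst (snd g))) (fst (snd h))"
  by (simp_all add: hall_mult_eq)

sublocale group H
proof (rule groupI)
  fix x y assume "x \<in> carrier H" "y \<in> carrier H"
  then show "x \<otimes>\<^bsub>H\<^esub> y \<in> carrier H"
    by (cases x, cases y) (simp add: add_mem bilin_mem)
next
  fix x y z assume "x \<in> carrier H" "y \<in> carrier H" "z \<in> carrier H"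
  obtain n u c m v d l w e where [simp]: "x = (n, u, c)" "y = (m, v, d)" "z = (l, w, e)"
    by (cases x, cases y, cases z)
  have "bilin b (shift (l + m) u) (shift l v) = bilin b (shift m u) v"
    using bilin_shift[of b l "shift m u" v] by simp
  then show "x \<otimes>\<^bsub>H\<^esub> y \<otimes>\<^bsub>H\<^esub> z = x \<otimes>\<^bsub>H\<^esub> (y \<otimes>\<^bsub>H\<^esub> z)"
    by (simp add: bilin_add_left bilin_add_right ac_simps)
next
  fix x assume "x \<in> carrier H"
  moreover obtain m v d where x: "x = (m, v, d)" by (cases x)
  moreover have "(- m, - shift (- m) v, bilin b v v - d) \<otimes>\<^bsub>H\<^esub> x = \<one>\<^bsub>H\<^esub>"
    by (simp add: x bilin_minus_left)
  moreover have "bilin b v v - d \<in> C" if "d \<in> C"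
    using add_mem[OF bilin_mem uminus_mem[OF that], of v v] by simp
  ultimately show "\<exists>y\<in>carrier H. y \<otimes>\<^bsub>H\<^esub> x = \<one>\<^bsub>H\<^esub>"
    by (auto intro!: bexI[of _ "(- m, - shift (- m) v, bilin b v v - d)"])
qed (auto simp: zero_mem)

text \<open>
In a power equal to \<open>1\<close> the coordinates vanish one after the other, because each is a multiple of
the original one as soon as the preceding ones are \<open>0\<close>.
\<close>
lemma torsion_free_hall: "torsion_free H"
proof -
  have "g = \<one>\<^bsub>H\<^esub>" if "k > 0" "g [^]\<^bsub>H\<^esub> k = \<one>\<^bsub>H\<^esub>" for g and k :: nat
  proof -
    obtain n u c where g: "g = (n, u, c)" by (cases g)
    have "fst (g [^]\<^bsub>H\<^esub> j) = int j * n" for j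
      by (induction j) (simp_all add: hall_mult_eq g algebra_simps)
    from this[of k] that have n: "n = 0" by simp
    have lu: "poly_mapping.lookup (fst (snd (g [^]\<^bsub>H\<^esub> j))) i = int j * poly_mapping.lookup u i" for i j
      by (induction j) (simp_all add: hall_mult_eq g n lookup_add algebra_simps)
    have u: "u = 0"
      by (rule poly_mapping_eqI) (use lu[of k] that in simp)
    have "snd (snd (g [^]\<^bsub>H\<^esub> j)) = of_nat j * c" for j
      by (induction j) (simp_all add: hall_mult_eq g n u algebra_simps)
    from this[of k] that have "c = 0" by simp
    with g n u show ?thesis by simp
  qed
  then show ?thesis by (simp add: torsion_free_def)
qed

text \<open>
Commuting with \<open>t\<close> makes \<open>u\<close> invariant under shifts, hence \<open>0\<close> by finite support; commuting with
\<open>a\<^sub>0\<close> then forces \<open>n = 0\<close>.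
\<close>
lemma hall_center:
  assumes "g \<in> carrier H"
  shows "(\<forall>h\<in>carrier H. g \<otimes>\<^bsub>H\<^esub> h = h \<otimes>\<^bsub>H\<^esub> g) \<longleftrightarrow> (\<exists>c\<in>C. g = (0, 0, c))"
proof
  assume comm: "\<forall>h\<in>carrier H. g \<otimes>\<^bsub>H\<^esub> h = h \<otimes>\<^bsub>H\<^esub> g"
  obtain n u c where g: "g = (n, u, c)" by (cases g)
  have "shift 1 u = u"
    using comm[rule_format, of "(1, 0, 0)"] by (simp add: g zero_mem)
  then have step: "poly_mapping.lookup u (i + 1) = poly_mapping.lookup u i" for i
    by (metis lookup_shift)
  have const: "poly_mapping.lookup u i = poly_mapping.lookup u 0" for i
  proof (induction i rule: int_induct[where k = 0])
    case (step2 i)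
    then show ?case using step[of "i - 1"] by simp
  qed (simp_all add: step)
  have "u = 0"
  proof (rule ccontr)
    assume "u \<noteq> 0"
    then obtain i where "poly_mapping.lookup u i \<noteq> 0"
      by (metis lookup_zero poly_mapping_eqI)
    then have "Poly_Mapping.keys u = UNIV"
      using const by (metis UNIV_eq_I in_keys_iff)
    then show False
      using finite_keys[of u] infinite_UNIV_int by simp
  qed
  moreover have "g \<otimes>\<^bsub>H\<^esub> (0, basis 0, 0) = (0, basis 0, 0) \<otimes>\<^bsub>H\<^esub> g"
    using comm by (simp add: zero_mem)
  then have "shift 0 u + basis 0 = shift n (basis 0) + u"
    by (simp only: g hall_simps prod.inject)
  then have "poly_mapping.lookup (shift 0 u + basis 0) 0 = poly_mapping.lookup (shift n (basis 0) + u) 0"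
    by (simp only:)
  then have "n = 0"
    by (simp add: \<open>u = 0\<close> lookup_single lookup_add when_def split: if_splits)
  ultimately show "\<exists>c\<in>C. g = (0, 0, c)"
    using assms g by auto
next
  assume "\<exists>c\<in>C. g = (0, 0, c)"
  then show "\<forall>h\<in>carrier H. g \<otimes>\<^bsub>H\<^esub> h = h \<otimes>\<^bsub>H\<^esub> g"
    by (auto simp: hall_group_def)
qed

lemma central_pow: "(0, 0, c) [^]\<^bsub>H\<^esub> (k::nat) = (0, 0, of_nat k * c)"
  by (induction k) (simp_all add: algebra_simps)

end

section \<open>Derived length three\<close>

context hall_data
begin

lemma inv_hall:
  assumes "d \<in> C"
  shows "inv\<^bsub>H\<^esub> (m, v, d) = (- m, - shift (- m) v, bilin b v v - d)"
proof (rule inv_equality)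
  show "(- m, - shift (- m) v, bilin b v v - d) \<otimes>\<^bsub>H\<^esub> (m, v, d) = \<one>\<^bsub>H\<^esub>"
    by (simp add: bilin_minus_left)
  show "(- m, - shift (- m) v, bilin b v v - d) \<in> carrier H"
    using add_mem[OF bilin_mem uminus_mem[OF assms], of v v] by simp
qed (use assms in simp)

lemma subgroup_fst_zero: "subgroup {g \<in> carrier H. fst g = 0} H"
proof (rule subgroupI)
  have "\<one>\<^bsub>H\<^esub> \<in> {g \<in> carrier H. fst g = 0}"
    by (simp add: zero_mem)
  then show "{g \<in> carrier H. fst g = 0} \<noteq> {}"
    by blast
  fix g assume "g \<in> {g \<in> carrier H. fst g = 0}"
  then show "inv\<^bsub>H\<^esub> g \<in> {g \<in> carrier H. fst g = 0}"
    using inv_closed[of g] by (cases g) (auto simp: inv_hall)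
qed (auto simp: hall_components simp del: hall_simps)

lemma subgroup_central: "subgroup {g \<in> carrier H. fst g = 0 \<and> fst (snd g) = 0} H"
proof (rule subgroupI)
  have "\<one>\<^bsub>H\<^esub> \<in> {g \<in> carrier H. fst g = 0 \<and> fst (snd g) = 0}"
    by (simp add: zero_mem)
  then show "{g \<in> carrier H. fst g = 0 \<and> fst (snd g) = 0} \<noteq> {}"
    by blast
  fix g assume "g \<in> {g \<in> carrier H. fst g = 0 \<and> fst (snd g) = 0}"
  then show "inv\<^bsub>H\<^esub> g \<in> {g \<in> carrier H. fst g = 0 \<and> fst (snd g) = 0}"
    using inv_closed[of g] by (cases g) (auto simp: inv_hall)
qed (auto simp: hall_components simp del: hall_simps)

lemma commutator_components:
  assumes "k \<otimes>\<^bsub>H\<^esub> (h \<otimes>\<^bsub>H\<^esub> g) = g \<otimes>\<^bsub>H\<^esub> h"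
  shows "fst k = 0"
    and "fst g = 0 \<Longrightarrow> fst h = 0 \<Longrightarrow> fst (snd k) = 0"
    and "fst g = 0 \<Longrightarrow> fst h = 0 \<Longrightarrow> fst (snd g) = 0 \<Longrightarrow> fst (snd h) = 0 \<Longrightarrow> snd (snd k) = 0"
  using assms by (cases g; cases h; cases k; simp)+

lemma derived_hall_1: "derived H (carrier H) \<subseteq> {g \<in> carrier H. fst g = 0}"
  by (rule derived_subset[OF _ subgroup_fst_zero]) (use commutator_components in blast)+

lemma derived_hall_2: "derived H {g \<in> carrier H. fst g = 0} \<subseteq> {g \<in> carrier H. fst g = 0 \<and> fst (snd g) = 0}"
  by (rule derived_subset[OF _ subgroup_central]) (use commutator_components in blast)+

lemma derived_hall_3: "derived H {g \<in> carrier H. fst g = 0 \<and> fst (snd g) = 0} \<subseteq> {\<one>\<^bsub>H\<^esub>}"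
proof (rule derived_subset[OF _ triv_subgroup])
  fix g h k assume "g \<in> {g \<in> carrier H. fst g = 0 \<and> fst (snd g) = 0}"
    "h \<in> {g \<in> carrier H. fst g = 0 \<and> fst (snd g) = 0}"
    and eq: "k \<otimes>\<^bsub>H\<^esub> (h \<otimes>\<^bsub>H\<^esub> g) = g \<otimes>\<^bsub>H\<^esub> h"
  then have "fst k = 0" "fst (snd k) = 0" "snd (snd k) = 0"
    using commutator_components[OF eq] by blast+
  then show "k \<in> {\<one>\<^bsub>H\<^esub>}"
    by (simp add: prod_eq_iff)
qed auto

text \<open>
Otherwise \<open>b k = k b 1\<close> for all \<open>k \<ge> 0\<close>. But \<open>b\<close> takes the value \<open>0\<close>, an element of \<open>C\<close>, at some
\<open>k \<ge> 1\<close>, so \<open>b 1 = 0\<close> and \<open>C\<close> would be trivial.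
\<close>
lemma second_difference_nonzero: "\<exists>k\<ge>1. 2 * b k - b (k - 1) - b (k + 1) \<noteq> 0"
proof (rule ccontr)
  assume "\<not> ?thesis"
  then have rec: "b (k + 1) = 2 * b k - b (k - 1)" if "k \<ge> 1" for k
    using that by fastforce
  have nat: "b (int k) = of_nat k * b 1 \<and> b (int k + 1) = of_nat (k + 1) * b 1" for k
  proof (induction k)
    case 0
    then show ?case by (simp add: b_nonpos)
  next
    case (Suc k)
    then show ?case using rec[of "int k + 1"] by (simp add: algebra_simps)
  qed
  then have lin: "b k = of_int k * b 1" if "k \<ge> 1" for k
    using that nat[of "nat k"] by simp
  obtain k where "k \<ge> 1" "b k = 0"
    using zero_mem b_range by (metis atLeast_iff imageE)
  then have "b 1 = 0" using lin[of k] by auto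
  then have "b k = 0" if "k \<ge> 1" for k using lin[OF that] by simp
  then have "b ` {1..} \<subseteq> {0}" by force
  then have "C \<subseteq> {0}" by (simp only: b_range)
  then show False using zero_mem nontrivial by auto
qed

text \<open>
The derived subgroup contains, up to central factors, \<open>a\<^sub>i\<^sub>+\<^sub>1 a\<^sub>i\<^sup>-\<^sup>1\<close> for every \<open>i\<close>. The commutator
of the elements for \<open>i = 0\<close> and \<open>i = k\<close> is a second difference of \<open>b\<close> at \<open>k\<close>, up to sign.
\<close>
lemma derived_hall_nontrivial: "(derived H ^^ 2) (carrier H) \<noteq> {\<one>\<^bsub>H\<^esub>}"
proof -
  let ?D = "derived H (carrier H)"
  \<comment> \<open>These are the commutators of \<open>t\<close> with \<open>a\<^sub>i\<close>.\<close>
  have diff: "\<exists>c. c \<in> C \<and> (0, basis (i + 1) - basis i, c) \<in> ?D" for i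
  proof -
    define c where "c = - bilin b (basis i - basis (i - 1)) (basis (i - 1))"
    have "(0, basis (i + 1) - basis i, c) \<in> ?D"
    proof (rule mem_derived)
      show "(1, 0, 0) \<in> carrier H" "(0, basis i, 0) \<in> carrier H" "(0, basis (i + 1) - basis i, c) \<in> carrier H"
        by (simp_all add: zero_mem c_def uminus_mem bilin_mem)
      show "(0, basis (i + 1) - basis i, c) \<otimes>\<^bsub>H\<^esub> ((0, basis i, 0) \<otimes>\<^bsub>H\<^esub> (1, 0, 0)) = (1, 0, 0) \<otimes>\<^bsub>H\<^esub> (0, basis i, 0)"
        by (simp add: c_def)
    qed simp
    moreover have "c \<in> C" by (simp add: c_def uminus_mem bilin_mem)
    ultimately show ?thesis by blast
  qed
  obtain k where k: "k \<ge> 1" "2 * b k - b (k - 1) - b (k + 1) \<noteq> 0"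
    using second_difference_nonzero by blast
  obtain c d where cd: "c \<in> C" "(0, basis (0 + 1) - basis 0, c) \<in> ?D" "d \<in> C" "(0, basis (k + 1) - basis k, d) \<in> ?D"
    using diff by blast
  let ?z = "(0, 0, 2 * b k - b (k - 1) - b (k + 1))"
  have "?z \<in> derived H ?D"
  proof (rule mem_derived[OF _ cd(2,4)])
    show "?D \<subseteq> carrier H" using derived_hall_1 by auto
    have "2 * b k - b (k - 1) - b (k + 1) = of_int 2 * b k + - b (k - 1) + - b (k + 1)" by simp
    also have "\<dots> \<in> C" by (intro add_mem uminus_mem of_int_mult_mem b_mem)
    finally show "?z \<in> carrier H" by simp
    show "?z \<otimes>\<^bsub>H\<^esub> ((0, basis (k + 1) - basis k, d) \<otimes>\<^bsub>H\<^esub> (0, basis (0 + 1) - basis 0, c)) =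
      (0, basis (0 + 1) - basis 0, c) \<otimes>\<^bsub>H\<^esub> (0, basis (k + 1) - basis k, d)"
      using k by (simp add: bilin_diff_left bilin_diff_right b_nonpos)
  qed
  then show ?thesis
    using k by (auto simp: numeral_2_eq_2)
qed

lemma step_solvable_hall: "step_solvable 3 H"
proof -
  have "derived H (derived H (derived H (carrier H))) \<subseteq> {\<one>\<^bsub>H\<^esub>}"
    by (rule order_trans[OF mono_derived[OF order_trans[OF mono_derived[OF derived_hall_1]
            derived_hall_2]] derived_hall_3])
  moreover have "\<one>\<^bsub>H\<^esub> \<in> (derived H ^^ 3) (carrier H)"
    using exp_of_derived_is_subgroup[OF subgroup_self] subgroup.one_closed by blast
  ultimately have 3: "(derived H ^^ 3) (carrier H) = {\<one>\<^bsub>H\<^esub>}"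
    by (auto simp: numeral_3_eq_3)
  have triv: "(derived H ^^ m) {\<one>\<^bsub>H\<^esub>} \<subseteq> {\<one>\<^bsub>H\<^esub>}" for m
    by (induction m) (use derived_incl[OF _ triv_subgroup] in auto)
  have "3 \<le> n" if n: "(derived H ^^ n) (carrier H) = {\<one>\<^bsub>H\<^esub>}" for n
  proof (rule ccontr)
    assume "\<not> 3 \<le> n"
    then have "2 = (2 - n) + n" by simp
    then have "(derived H ^^ 2) (carrier H) = (derived H ^^ (2 - n)) ((derived H ^^ n) (carrier H))"
      by (metis comp_apply funpow_add)
    then have "(derived H ^^ 2) (carrier H) \<subseteq> {\<one>\<^bsub>H\<^esub>}"
      using triv n by simp
    moreover have "\<one>\<^bsub>H\<^esub> \<in> (derived H ^^ 2) (carrier H)"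
      using exp_of_derived_is_subgroup[OF subgroup_self] subgroup.one_closed by blast
    ultimately show False
      using derived_hall_nontrivial by blast
  qed
  then have "derived_length H = 3"
    unfolding derived_length_def using 3 by (intro Least_equality)
  moreover have "solvable H"
    using 3 solvable_iff_trivial_derived_seq by blast
  ultimately show ?thesis by (simp add: step_solvable_def)
qed

section \<open>Two generators\<close>

abbreviation x\<^sub>0 :: hall_elt where "x\<^sub>0 \<equiv> (1, 0, 0)"
abbreviation y\<^sub>0 :: hall_elt where "y\<^sub>0 \<equiv> (1, basis 0, 0)"

text \<open>
From \<open>t = x\<close> and \<open>a\<^sub>0 = x\<^sup>-\<^sup>1 y\<close> conjugation gives all \<open>a\<^sub>i\<close>, the commutators of \<open>a\<^sub>0\<close> with the
\<open>a\<^sub>k\<close> give all of \<open>C\<close>, and together these produce every triple.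
\<close>
lemma generate_hall: "generate H {x\<^sub>0, y\<^sub>0} = carrier H"
proof
  have sub: "subgroup (generate H {x\<^sub>0, y\<^sub>0}) H"
    by (intro generate_is_subgroup) (simp add: zero_mem)
  define T where "T = generate H {x\<^sub>0, y\<^sub>0}"
  have T: "subgroup T H" using sub by (simp add: T_def)
  note mult = subgroup.m_closed[OF T] and inv = subgroup.m_inv_closed[OF T] and one = subgroup.one_closed[OF T]
  have xy: "x\<^sub>0 \<in> T" "y\<^sub>0 \<in> T" unfolding T_def by (auto intro: generate.incl)
  have tinv: "(-1, 0, 0) \<in> T" using inv[OF xy(1)] by (simp add: inv_hall zero_mem)
  have tpow: "(n, 0, 0) \<in> T" for n
  proof (induction n rule: int_induct[where k = 0])
    case base
    then show ?case using one by simp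
  next
    case (step1 i)
    then show ?case using mult[OF _ xy(1)] by force
  next
    case (step2 i)
    then show ?case using mult[OF _ tinv] by force
  qed
  have a0: "(0, basis 0, 0) \<in> T" using mult[OF tinv xy(2)] by simp
  have a: "(0, basis i, 0) \<in> T" for i
    using mult[OF tpow[of i] mult[OF a0 tpow[of "- i"]]] by simp
  have central: "(0, 0, c) \<in> T" if "c \<in> C" for c
  proof -
    have "c \<in> b ` {1..}" using that by (simp only: b_range)
    then obtain k where k: "k \<ge> 1" "c = b k" by auto
    have 1: "(0, basis 0 + basis k, b k) \<in> T"
      using mult[OF a[of 0] a[of k]] by simp
    have "(0, basis 0 + basis k, 0) \<in> T"
      using mult[OF a[of k] a[of 0]] k by (simp add: b_nonpos add.commute)
    then have "(0, basis 0 + basis k, b k) \<otimes>\<^bsub>H\<^esub> inv\<^bsub>H\<^esub> (0, basis 0 + basis k, 0) \<in> T"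
      using 1 by (intro mult inv)
    moreover have "(0, basis 0 + basis k, b k) \<otimes>\<^bsub>H\<^esub> inv\<^bsub>H\<^esub> (0, basis 0 + basis k, 0) = (0, 0, b k)"
      by (simp add: inv_hall zero_mem bilin_minus_right bilin_add_right bilin_diff_right del: bilin_basis)
    ultimately show ?thesis using k by simp
  qed
  \<comment> \<open>Once the centre is available, the last coordinate can be ignored.\<close>
  have lift: "(0, u, d) \<in> T" if "(0, u, c) \<in> T" "d - c \<in> C" for u c d
    using mult[OF that(1) central[OF that(2)]] by simp
  define V where "V = {u. (0, u, 0) \<in> T}"
  have V_add: "u + v \<in> V" if "u \<in> V" "v \<in> V" for u v
    using that lift[of "u + v" "bilin b u v" 0] mult[of "(0, u, 0)" "(0, v, 0)"] uminus_mem[OF bilin_mem]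
    by (simp add: V_def)
  have V_minus: "- u \<in> V" if "u \<in> V" for u
    using that lift[of "- u" "bilin b u u" 0] inv[of "(0, u, 0)"] uminus_mem[OF bilin_mem]
    by (simp add: V_def inv_hall zero_mem)
  have V_all: "u \<in> V" for u
    using subset_UNIV
  proof (induction u rule: frag_induction)
    case zero
    then show ?case using one by (simp add: V_def)
  next
    case (one i)
    then show ?case using a by (simp add: V_def)
  next
    case (diff u v)
    then show ?case using V_add[OF _ V_minus, of u v] by simp
  qed
  show "carrier H \<subseteq> generate H {x\<^sub>0, y\<^sub>0}"
  proof
    fix g assume g: "g \<in> carrier H"
    obtain n u c where [simp]: "g = (n, u, c)" by (cases g)
    have "(0, u, c) \<in> T" using V_all[of u] g lift[of u 0 c] by (simp add: V_def)
    then have "(n, u, c) \<in> T" using mult[OF tpow[of n]] by force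
    then show "g \<in> generate H {x\<^sub>0, y\<^sub>0}" by (simp add: T_def)
  qed
  show "generate H {x\<^sub>0, y\<^sub>0} \<subseteq> carrier H"
    using subgroup.subset[OF sub] .
qed

end

section \<open>Foelner sets of the group\<close>

text \<open>
The indices are \<open>- n\<close> for \<open>0 \<le> n < N\<close>: at an element with first coordinate \<open>n\<close>, the generator
\<open>y\<close> increases exactly the coordinate \<open>- n\<close> of \<open>u\<close>.
\<close>
definition box :: "int \<Rightarrow> (int \<Rightarrow>\<^sub>0 int) set" where
  "box N = {u. \<forall>i. if i \<in> {-N<..0} then poly_mapping.lookup u i \<in> {0..<N} else poly_mapping.lookup u i = 0}"

lemma boxD:
  assumes "u \<in> box N"
  shows "i \<in> {-N<..0} \<Longrightarrow> 0 \<le> poly_mapping.lookup u i \<and> poly_mapping.lookup u i < N"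
    and "i \<notin> {-N<..0} \<Longrightarrow> poly_mapping.lookup u i = 0"
  using assms by (auto simp: box_def split: if_splits)

lemma boxI:
  assumes "\<And>i. i \<in> {-N<..0} \<Longrightarrow> 0 \<le> poly_mapping.lookup u i \<and> poly_mapping.lookup u i < N"
    and "\<And>i. i \<notin> {-N<..0} \<Longrightarrow> poly_mapping.lookup u i = 0"
  shows "u \<in> box N"
  using assms by (auto simp: box_def)

lemma finite_box: "finite (box N)"
proof (rule finite_imageD)
  let ?f = "\<lambda>u. restrict (poly_mapping.lookup u) {-N<..0}"
  show "finite (?f ` box N)"
    by (rule finite_subset[of _ "{-N<..0} \<rightarrow>\<^sub>E {0..<N}"]) (auto simp: finite_PiE dest: boxD)
  show "inj_on ?f (box N)"
  proof (rule inj_onI, rule poly_mapping_eqI)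
    fix u v i assume uv: "u \<in> box N" "v \<in> box N" "?f u = ?f v"
    show "poly_mapping.lookup u i = poly_mapping.lookup v i"
    proof (cases "i \<in> {-N<..0}")
      case True
      then show ?thesis using fun_cong[OF uv(3), of i] by simp
    qed (simp add: boxD(2)[OF uv(1)] boxD(2)[OF uv(2)])
  qed
qed

lemma zero_mem_box: "0 < N \<Longrightarrow> 0 \<in> box N"
  by (auto simp: box_def)

text \<open>
Lowering the coordinate \<open>i\<close> by \<open>0, \<dots>, N - 1\<close> gives \<open>N\<close> disjoint copies of the face inside the box.
\<close>
lemma card_box_face:
  assumes i: "i \<in> {-N<..0}"
  shows "N * int (card {u \<in> box N. poly_mapping.lookup u i = N - 1}) \<le> int (card (box N))"
proof -
  let ?V = "{u \<in> box N. poly_mapping.lookup u i = N - 1}"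
  let ?f = "\<lambda>(u, l). u - Poly_Mapping.single i l"
  have N: "N > 0" using i by auto
  have "inj_on ?f (?V \<times> {0..<N})"
  proof (rule inj_onI, clarify)
    fix u l v m
    assume eq: "u - Poly_Mapping.single i l = v - Poly_Mapping.single i m"
      and face: "poly_mapping.lookup u i = N - 1" "poly_mapping.lookup v i = N - 1"
    have "poly_mapping.lookup (u - Poly_Mapping.single i l) i = poly_mapping.lookup (v - Poly_Mapping.single i m) i"
      using eq by (simp only:)
    then have "l = m" using face by (simp add: lookup_minus)
    with eq show "u = v \<and> l = m" by simp
  qed
  moreover have "?f ` (?V \<times> {0..<N}) \<subseteq> box N"
  proof clarify
    fix u l assume u: "u \<in> box N" "poly_mapping.lookup u i = N - 1" and l: "l \<in> {0..<N}"
    show "u - Poly_Mapping.single i l \<in> box N"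
      by (rule boxI) (use boxD[OF u(1)] u(2) l i in \<open>auto simp: lookup_minus lookup_single when_def\<close>)
  qed
  ultimately have "card (?V \<times> {0..<N}) \<le> card (box N)"
    using finite_box by (rule card_inj_on_le)
  then have "int (card ?V * card {0..<N}) \<le> int (card (box N))"
    by (simp only: card_cartesian_product of_nat_le_iff)
  then show ?thesis using N by (simp add: mult.commute)
qed

context hall_data
begin

text \<open>
How far the centre coordinate can move when a generator acts on an element of the Foelner set,
measured in units of a common divisor \<open>e\<close> of the values of \<open>b\<close> on \<open>[-N, N]\<close>.
\<close>
lemma bilin_box_bound:
  assumes u: "u \<in> box N" and n: "n \<in> {0..<N}"
    and m: "\<And>k. k \<in> {-N..N} \<Longrightarrow> b k = of_int (m k) * e"
    and w: "w = 0 \<or> w = basis 0"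
  shows "\<exists>t. \<bar>t\<bar> \<le> N * N * (\<Sum>k\<in>{-N..N}. \<bar>m k\<bar>) \<and> bilin b (shift n w) u = of_int t * e"
proof -
  let ?M = "\<Sum>k\<in>{-N..N}. \<bar>m k\<bar>"
  have N: "N > 0" using n by auto
  have M0: "0 \<le> ?M" by (simp add: sum_nonneg)
  show ?thesis
    using w
  proof
    assume "w = 0"
    then show ?thesis using N M0 by (intro exI[of _ 0]) simp
  next
    assume w: "w = basis 0"
    define t where "t = (\<Sum>j\<in>{-N<..0}. poly_mapping.lookup u j * m (j + n))"
    have "Poly_Mapping.keys u \<subseteq> {-N<..0}"
      using boxD(2)[OF u] by (force simp: in_keys_iff)
    then have "bilin b (shift n w) u = (\<Sum>j\<in>{-N<..0}. of_int (poly_mapping.lookup u j) * b (j + n))"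
      unfolding w shift_simps bilin_basis_left
      by (intro sum.mono_neutral_cong_left) (auto simp: in_keys_iff)
    also have "\<dots> = (\<Sum>j\<in>{-N<..0}. of_int (poly_mapping.lookup u j * m (j + n)) * e)"
      using n by (intro sum.cong) (auto simp: m)
    also have "\<dots> = of_int t * e"
      by (simp add: t_def sum_distrib_right)
    finally have eq: "bilin b (shift n w) u = of_int t * e" .
    have "\<bar>t\<bar> \<le> (\<Sum>j\<in>{-N<..0}. \<bar>poly_mapping.lookup u j * m (j + n)\<bar>)"
      unfolding t_def by (rule sum_abs)
    also have "\<dots> \<le> (\<Sum>j\<in>{-N<..0}. N * ?M)"
    proof (rule sum_mono)
      fix j assume j: "j \<in> {-N<..0}"
      have "\<bar>m (j + n)\<bar> \<le> ?M"
        using j n by (intro member_le_sum) auto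
      then show "\<bar>poly_mapping.lookup u j * m (j + n)\<bar> \<le> N * ?M"
        unfolding abs_mult using boxD(1)[OF u j] by (intro mult_mono) auto
    qed
    also have "\<dots> = N * N * ?M" using N by simp
    finally show ?thesis using eq by blast
  qed
qed

text \<open>
Left multiplication by \<open>x\<close> or \<open>y\<close> maps \<open>(n, u, c)\<close> to \<open>(n + 1, u', c')\<close>, where \<open>u'\<close> is \<open>u\<close> or
\<open>u\<close> plus the basis vector with index \<open>- n\<close>, and \<open>c' - c\<close> is a multiple of \<open>e\<close> by an integer of
absolute value at most \<open>W\<close>. The Foelner set consists of the triples with \<open>0 \<le> n < N\<close>, with \<open>u\<close> in
the box of side \<open>N\<close> over the indices \<open>- n\<close> that occur, and with \<open>c = k e\<close>, \<open>0 \<le> k < K\<close>. A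
generator can only leave it from three boundary parts: the last value of \<open>n\<close> (\<open>B1\<close>), a face of the
box (\<open>B2\<close>), or the two ends of the range of \<open>k\<close> (\<open>B3\<close>). Their proportions are at most \<open>1 / N\<close>,
\<open>1 / N\<close> and \<open>2 W / K\<close>; since \<open>W\<close> depends on \<open>N\<close> only, \<open>K\<close> can be chosen last.
\<close>
lemma foelner_hall: "foelner H {x\<^sub>0, y\<^sub>0}"
  unfolding foelner_def
proof (intro allI impI)
  fix \<epsilon> :: real assume eps: "\<epsilon> > 0"
  obtain N0 :: nat where N0: "3 / \<epsilon> < real N0"
    using reals_Archimedean2 by blast
  define N where "N = int N0 + 1"
  have N: "N > 0" "3 / \<epsilon> \<le> of_int N" using N0 by (auto simp: N_def)
  have "finite (b ` {-N..N})" "b ` {-N..N} \<subseteq> C" using b_mem by auto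
  then obtain e where e: "e \<in> C" "0 < e" "\<forall>c\<in>b ` {-N..N}. \<exists>k. c = of_int k * e"
    using locally_cyclic by blast
  then obtain m where m: "\<And>k. k \<in> {-N..N} \<Longrightarrow> b k = of_int (m k) * e"
    using bchoice[of "{-N..N}" "\<lambda>k j. b k = of_int j * e"] by auto
  define W where "W = N * N * (\<Sum>k\<in>{-N..N}. \<bar>m k\<bar>)"
  have W: "0 \<le> W" using N by (simp add: W_def sum_nonneg)
  obtain K0 :: nat where K0: "6 * of_int W / \<epsilon> < real K0"
    using reals_Archimedean2 by blast
  define K where "K = int K0 + 1"
  have K: "K > 0" "6 * of_int W / \<epsilon> \<le> of_int K" using K0 by (auto simp: K_def)
  define P :: "int \<times> (int \<Rightarrow>\<^sub>0 int) \<times> int \<Rightarrow> hall_elt" where "P = (\<lambda>(n, u, k). (n, u, of_int k * e))"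
  have inj: "inj P" using e by (auto simp: P_def inj_def)
  define D where "D = {0..<N} \<times> box N \<times> {0..<K}"
  define F where "F = P ` D"
  have fin: "finite D" by (simp add: D_def finite_box)
  have cardF: "real (card F) = of_int N * real (card (box N)) * of_int K"
    using N K inj_on_subset[OF inj] by (simp add: F_def card_image D_def card_cartesian_product)
  define B1 where "B1 = {N - 1} \<times> box N \<times> {0..<K}"
  define B2 where "B2 = (SIGMA n:{0..<N}. {u \<in> box N. poly_mapping.lookup u (- n) = N - 1} \<times> {0..<K})"
  define B3 where "B3 = {0..<N} \<times> box N \<times> ({0..<W} \<union> {K - W..<K})"
  have fB: "finite B1" "finite B2" "finite B3"
    by (auto simp: B1_def B2_def B3_def finite_box)
  have b1: "real (card B1) \<le> \<epsilon> / 3 * real (card F)"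
  proof -
    have "1 \<le> \<epsilon> / 3 * of_int N" using N(2) eps by (simp add: field_simps)
    then have "1 * (real (card (box N)) * of_int K) \<le> \<epsilon> / 3 * of_int N * (real (card (box N)) * of_int K)"
      using K by (intro mult_right_mono) auto
    then show ?thesis using K by (simp add: B1_def card_cartesian_product cardF mult.assoc)
  qed
  have b2: "real (card B2) \<le> \<epsilon> / 3 * real (card F)"
  proof -
    have "real (card B2) = (\<Sum>n\<in>{0..<N}. real (card {u \<in> box N. poly_mapping.lookup u (- n) = N - 1}) * of_int K)"
      unfolding B2_def using K by (subst card_SigmaI) (auto simp: finite_box card_cartesian_product)
    also have "\<dots> \<le> (\<Sum>n\<in>{0..<N}. real (card (box N)) / of_int N * of_int K)"
    proof (intro sum_mono mult_right_mono)
      fix n assume "n \<in> {0..<N}"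
      then have "- n \<in> {-N<..0}" by auto
      then have "real_of_int (N * int (card {u \<in> box N. poly_mapping.lookup u (- n) = N - 1})) \<le> real_of_int (int (card (box N)))"
        by (simp only: of_int_le_iff card_box_face)
      then show "real (card {u \<in> box N. poly_mapping.lookup u (- n) = N - 1}) \<le> real (card (box N)) / of_int N"
        using N by (simp add: field_simps)
    qed (use K in auto)
    also have "\<dots> = real (card B1)" using N K by (simp add: B1_def card_cartesian_product)
    finally show ?thesis using b1 by simp
  qed
  have b3: "real (card B3) \<le> \<epsilon> / 3 * real (card F)"
  proof -
    have "real (card ({0..<W} \<union> {K - W..<K})) \<le> 2 * of_int W"
      using card_Un_le[of "{0..<W}" "{K - W..<K}"] W by simp
    also have "2 * of_int W \<le> \<epsilon> / 3 * of_int K" using K(2) eps by (simp add: field_simps)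
    finally have "(of_int N * real (card (box N))) * real (card ({0..<W} \<union> {K - W..<K})) \<le>
      (of_int N * real (card (box N))) * (\<epsilon> / 3 * of_int K)"
      using N by (intro mult_left_mono) auto
    then show ?thesis
      using N by (simp add: B3_def card_cartesian_product cardF algebra_simps)
  qed
  have stay: "(1, w, 0) \<otimes>\<^bsub>H\<^esub> P d \<in> F"
    if w: "w = 0 \<or> w = basis 0" and d: "d \<in> D" "d \<notin> B1 \<union> B2 \<union> B3" for w d
  proof -
    obtain n u k where [simp]: "d = (n, u, k)" by (cases d)
    from d have n: "n \<in> {0..<N}" and u: "u \<in> box N" and k: "0 \<le> k" "k < K"
      and n1: "n \<noteq> N - 1" and un: "poly_mapping.lookup u (- n) \<noteq> N - 1" and kW: "W \<le> k" "k < K - W"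
      by (auto simp: D_def B1_def B2_def B3_def)
    obtain t where t: "\<bar>t\<bar> \<le> W" "bilin b (shift n w) u = of_int t * e"
      using bilin_box_bound[OF u n m w] unfolding W_def by blast
    have ul: "poly_mapping.lookup u (- n) < N - 1"
      using boxD(1)[OF u, of "- n"] n un by auto
    have "shift n w + u \<in> box N"
      using w
    proof
      assume "w = basis 0"
      then show ?thesis
        by (intro boxI) (use boxD[OF u] ul n in \<open>auto simp: lookup_add lookup_single when_def\<close>)
    qed (use u in simp)
    then have "(1 + n, shift n w + u, k + t) \<in> D"
      using n n1 kW t(1) by (auto simp: D_def)
    moreover have "(1, w, 0) \<otimes>\<^bsub>H\<^esub> P d = P (1 + n, shift n w + u, k + t)"
      by (simp add: P_def t(2) distrib_right)
    ultimately show ?thesis by (simp add: F_def)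
  qed
  have "real (card ((\<lambda>g. s \<otimes>\<^bsub>H\<^esub> g) ` F - F)) \<le> \<epsilon> * real (card F)" if s: "s \<in> {x\<^sub>0, y\<^sub>0}" for s
  proof -
    obtain w where w: "s = (1, w, 0)" "w = 0 \<or> w = basis 0"
      using s by auto
    have "(\<lambda>g. s \<otimes>\<^bsub>H\<^esub> g) ` F - F \<subseteq> (\<lambda>d. s \<otimes>\<^bsub>H\<^esub> P d) ` (B1 \<union> B2 \<union> B3)"
    proof
      have image: "(\<lambda>g. s \<otimes>\<^bsub>H\<^esub> g) ` F = (\<lambda>d. s \<otimes>\<^bsub>H\<^esub> P d) ` D"
        by (simp add: F_def image_image)
      fix g assume "g \<in> (\<lambda>g. s \<otimes>\<^bsub>H\<^esub> g) ` F - F"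
      then have "g \<in> (\<lambda>d. s \<otimes>\<^bsub>H\<^esub> P d) ` D" and nF: "g \<notin> F"
        by (simp_all only: image Diff_iff not_False_eq_True)
      then obtain d where d: "d \<in> D" "g = s \<otimes>\<^bsub>H\<^esub> P d"
        by (elim imageE)
      have "d \<in> B1 \<union> B2 \<union> B3"
        using nF stay[OF w(2) d(1)] unfolding w(1)[symmetric] d(2)[symmetric] by (rule contrapos_np)
      then show "g \<in> (\<lambda>d. s \<otimes>\<^bsub>H\<^esub> P d) ` (B1 \<union> B2 \<union> B3)"
        unfolding d(2) by (rule imageI)
    qed
    then have "card ((\<lambda>g. s \<otimes>\<^bsub>H\<^esub> g) ` F - F) \<le> card (B1 \<union> B2 \<union> B3)"
      using fB by (intro surj_card_le) auto
    also have "\<dots> \<le> card B1 + card B2 + card B3"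
      using card_Un_le[of "B1 \<union> B2" B3] card_Un_le[of B1 B2] by linarith
    finally have "real (card ((\<lambda>g. s \<otimes>\<^bsub>H\<^esub> g) ` F - F)) \<le> real (card B1) + real (card B2) + real (card B3)"
      by linarith
    then show ?thesis using b1 b2 b3 by linarith
  qed
  moreover have "finite F" "F \<noteq> {}"
    using fin N K zero_mem_box[of N] by (auto simp: F_def D_def)
  moreover have "F \<subseteq> carrier H"
    using of_int_mult_mem[OF e(1)] by (auto simp: F_def P_def)
  ultimately show "\<exists>F. finite F \<and> F \<noteq> {} \<and> F \<subseteq> carrier H \<and>
      (\<forall>s\<in>{x\<^sub>0, y\<^sub>0}. real (card ((\<lambda>g. s \<otimes>\<^bsub>H\<^esub> g) ` F - F)) \<le> \<epsilon> * real (card F))"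
    by blast
qed

end

section \<open>Recovering the set of primes from the centre\<close>

definition central_divisible :: "('a, 'b) monoid_scheme \<Rightarrow> nat \<Rightarrow> bool" where
  "central_divisible G p \<longleftrightarrow> (let Z = {z \<in> carrier G. \<forall>g\<in>carrier G. z \<otimes>\<^bsub>G\<^esub> g = g \<otimes>\<^bsub>G\<^esub> z}
     in \<forall>z\<in>Z. \<exists>w\<in>Z. w [^]\<^bsub>G\<^esub> p = z)"

lemma (in hall_data) central_divisible_hall:
  "central_divisible H p \<longleftrightarrow> (\<forall>c\<in>C. \<exists>d\<in>C. of_nat p * d = c)"
proof -
  have "{z \<in> carrier H. \<forall>g\<in>carrier H. z \<otimes>\<^bsub>H\<^esub> g = g \<otimes>\<^bsub>H\<^esub> z} = (\<lambda>c. (0, 0, c)) ` C"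
    (is "?Z = _")
  proof -
    have "?Z = {z \<in> carrier H. \<exists>c\<in>C. z = (0, 0, c)}"
      using hall_center by blast
    then show ?thesis by auto
  qed
  then show ?thesis
    by (simp add: central_divisible_def central_pow)
qed

text \<open>
The subring \<open>\<int>[1/p : p \<in> P]\<close> of the rationals.
\<close>
definition localized_integers :: "nat set \<Rightarrow> rat set" where
  "localized_integers P = {c. \<exists>a d. 0 < d \<and> (\<forall>p. prime p \<longrightarrow> p dvd d \<longrightarrow> p \<in> P) \<and> c = of_int a / of_nat d}"

lemma localized_integersI:
  "0 < d \<Longrightarrow> (\<And>p. prime p \<Longrightarrow> p dvd d \<Longrightarrow> p \<in> P) \<Longrightarrow> c = of_int a / of_nat d \<Longrightarrow> c \<in> localized_integers P"
  by (auto simp: localized_integers_def)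

lemma of_int_mem_localized: "of_int a \<in> localized_integers P"
  by (rule localized_integersI[of 1 _ _ a]) auto

text \<open>
Any enumeration of the centre by the positive integers would serve.
\<close>
definition centre_sequence :: "nat set \<Rightarrow> int \<Rightarrow> rat" where
  "centre_sequence P k = (if k \<le> 0 then 0 else from_nat_into (localized_integers P) (nat k - 1))"

text \<open>
A common denominator of finitely many elements is again a product of primes in \<open>P\<close>.
\<close>
lemma localized_integers_locally_cyclic:
  assumes "finite X" "X \<subseteq> localized_integers P"
  shows "\<exists>d>0. (\<forall>p. prime p \<longrightarrow> p dvd d \<longrightarrow> p \<in> P) \<and> (\<forall>c\<in>X. \<exists>k. c = of_int k / of_nat d)"
  using assms
proof (induction rule: finite_induct)
  case empty
  show ?case by (intro exI[of _ 1]) auto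
next
  case (insert c X)
  then obtain d where d: "0 < d" "\<forall>p. prime p \<longrightarrow> p dvd d \<longrightarrow> p \<in> P" "\<forall>c\<in>X. \<exists>k. c = of_int k / of_nat d"
    by auto
  obtain a d' where c: "0 < d'" "\<forall>p. prime p \<longrightarrow> p dvd d' \<longrightarrow> p \<in> P" "c = of_int a / of_nat d'"
    using insert.prems by (auto simp: localized_integers_def)
  have "\<exists>k. x = of_int k / of_nat (d * d')" if "x \<in> insert c X" for x
  proof (cases "x = c")
    case True
    then have "x = of_int (a * int d) / of_nat (d * d')" using c d by simp
    then show ?thesis by blast
  next
    case False
    then have "x \<in> X" using that by simp
    then obtain k where "x = of_int k / of_nat d" using d(3) by blast
    then have "x = of_int (k * int d') / of_nat (d * d')" using c by simp
    then show ?thesis by blast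
  qed
  then show ?case
    using c d by (intro exI[of _ "d * d'"] conjI ballI) (simp_all add: prime_dvd_mult_iff)
qed

lemma hall_data_localized: "hall_data (localized_integers P) (centre_sequence P)"
proof
  let ?C = "localized_integers P"
  show "0 \<in> ?C" using of_int_mem_localized[of 0 P] by simp
  show "c + d \<in> ?C" if cd: "c \<in> ?C" "d \<in> ?C" for c d
  proof -
    obtain k where k: "0 < k" "\<forall>p. prime p \<longrightarrow> p dvd k \<longrightarrow> p \<in> P" "\<forall>x\<in>{c, d}. \<exists>l. x = of_int l / of_nat k"
      using localized_integers_locally_cyclic[of "{c, d}" P] cd by auto
    then obtain l m where "c = of_int l / of_nat k" "d = of_int m / of_nat k" by auto
    then have "c + d = of_int (l + m) / of_nat k" by (simp add: add_divide_distrib)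
    then show ?thesis using k by (intro localized_integersI[of k P _ "l + m"]) auto
  qed
  show "- c \<in> ?C" if "c \<in> ?C" for c
    using that unfolding localized_integers_def by clarsimp (metis minus_divide_left of_int_minus)
  show "centre_sequence P k = 0" if "k \<le> 0" for k
    using that by (simp add: centre_sequence_def)
  show "centre_sequence P ` {1..} = ?C"
  proof -
    have "centre_sequence P ` {1..} = range (from_nat_into ?C)"
    proof (intro Set.set_eqI iffI)
      fix c assume "c \<in> range (from_nat_into ?C)"
      then obtain n where "c = from_nat_into ?C n" by auto
      then have "c = centre_sequence P (int n + 1)" by (simp add: centre_sequence_def nat_add_distrib)
      then show "c \<in> centre_sequence P ` {1..}" by auto
    qed (auto simp: centre_sequence_def)
    then show ?thesis
      using of_int_mem_localized by (metis countableI_type empty_iff range_from_nat_into)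
  qed
  show "?C \<noteq> {0}" using of_int_mem_localized[of 1 P] by auto
  show "\<exists>e\<in>?C. 0 < e \<and> (\<forall>c\<in>X. \<exists>k. c = of_int k * e)" if X: "finite X" "X \<subseteq> ?C" for X
  proof -
    obtain d where d: "0 < d" "\<forall>p. prime p \<longrightarrow> p dvd d \<longrightarrow> p \<in> P" "\<forall>c\<in>X. \<exists>k. c = of_int k / of_nat d"
      using localized_integers_locally_cyclic[OF X] by blast
    then show ?thesis
      by (intro bexI[of _ "1 / of_nat d"] localized_integersI[of d P _ 1]) auto
  qed
qed

text \<open>
If \<open>1\<close> is divisible by \<open>p\<close> then \<open>1/p = a/k\<close> with all prime factors of \<open>k\<close> in \<open>P\<close>, and \<open>p\<close>
divides \<open>k = p a\<close>.
\<close>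
lemma localized_integers_divisible_iff:
  assumes p: "prime p"
  shows "(\<forall>c\<in>localized_integers P. \<exists>d\<in>localized_integers P. of_nat p * d = c) \<longleftrightarrow> p \<in> P"
proof
  assume "p \<in> P"
  show "\<forall>c\<in>localized_integers P. \<exists>d\<in>localized_integers P. of_nat p * d = c"
  proof
    fix c assume "c \<in> localized_integers P"
    then obtain a d where c: "0 < d" "\<forall>p. prime p \<longrightarrow> p dvd d \<longrightarrow> p \<in> P" "c = of_int a / of_nat d"
      by (auto simp: localized_integers_def)
    have "of_nat p * (of_int a / of_nat (p * d)) = c"
      using c p by (simp add: prime_gt_0_nat)
    moreover have "of_int a / of_nat (p * d) \<in> localized_integers P"
    proof (rule localized_integersI)
      fix q assume "prime q" "q dvd p * d"
      then show "q \<in> P" using c \<open>p \<in> P\<close> p by (metis prime_dvd_mult_iff primes_dvd_imp_eq)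
    qed (use c p in \<open>auto simp: prime_gt_0_nat\<close>)
    ultimately show "\<exists>d\<in>localized_integers P. of_nat p * d = c" by blast
  qed
next
  assume "\<forall>c\<in>localized_integers P. \<exists>d\<in>localized_integers P. of_nat p * d = c"
  then obtain d where d: "d \<in> localized_integers P" "of_nat p * d = 1"
    using of_int_mem_localized[of 1 P] by auto
  then obtain a k where k: "0 < k" "\<forall>p. prime p \<longrightarrow> p dvd k \<longrightarrow> p \<in> P" "d = of_int a / of_nat k"
    by (auto simp: localized_integers_def)
  have "of_int (int p * a) = (of_int (int k) :: rat)"
    using d(2) k by (simp add: field_simps)
  then have "int p * a = int k" by (simp only: of_int_eq_iff)
  then have "p dvd k" by (metis dvd_triv_left int_dvd_int_iff)
  then show "p \<in> P" using k p by blast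
qed

section \<open>Transport to the natural numbers\<close>

text \<open>
A finitely supported function is determined by the finite graph of its nonzero part.
\<close>
lemma countable_finitely_supported: "countable (UNIV :: ('a::countable \<Rightarrow>\<^sub>0 'b::{countable,zero}) set)"
proof -
  let ?graph = "\<lambda>u :: 'a \<Rightarrow>\<^sub>0 'b. (\<lambda>i. (i, poly_mapping.lookup u i)) ` Poly_Mapping.keys u"
  have "inj ?graph"
  proof (rule injI, rule poly_mapping_eqI)
    fix u v :: "'a \<Rightarrow>\<^sub>0 'b" and i
    assume eq: "?graph u = ?graph v"
    have sub: "poly_mapping.lookup w i = poly_mapping.lookup w' i"
      if "?graph w = ?graph w'" "i \<in> Poly_Mapping.keys w" for w w' :: "'a \<Rightarrow>\<^sub>0 'b"
    proof -
      have "(i, poly_mapping.lookup w i) \<in> ?graph w'"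
        using that(2) by (simp only: that(1)[symmetric]) auto
      then show ?thesis by auto
    qed
    show "poly_mapping.lookup u i = poly_mapping.lookup v i"
      using sub[OF eq] sub[OF eq[symmetric]] by (metis in_keys_iff)
  qed
  moreover have "countable (range ?graph)"
    by (rule countable_subset[OF _ countable_Collect_finite]) auto
  ultimately show ?thesis
    by (metis countable_image_inj_on)
qed

definition nat_copy :: "('a, 'b) monoid_scheme \<Rightarrow> nat monoid" where
  "nat_copy G = (let h = to_nat_on (carrier G); h' = inv_into (carrier G) h in
     \<lparr>carrier = h ` carrier G, mult = (\<lambda>a b. h (h' a \<otimes>\<^bsub>G\<^esub> h' b)), one = h \<one>\<^bsub>G\<^esub>\<rparr>)"

lemma (in group) nat_copy:
  assumes "countable (carrier G)"
  shows "to_nat_on (carrier G) \<in> iso G (nat_copy G)" and "group (nat_copy G)"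
proof -
  have inj: "inj_on (to_nat_on (carrier G)) (carrier G)"
    by (rule inj_on_to_nat_on[OF assms])
  then show iso: "to_nat_on (carrier G) \<in> iso G (nat_copy G)"
    by (auto simp: iso_def hom_def nat_copy_def Let_def bij_betw_def)
  have "nat_copy G\<lparr>one := to_nat_on (carrier G) \<one>\<rparr> = nat_copy G"
    by (simp add: nat_copy_def Let_def)
  then show "group (nat_copy G)"
    using iso_imp_img_group[OF iso] by simp
qed

locale group_iso = group_hom G H h for G (structure) and H (structure) and h +
  assumes iso: "h \<in> iso G H"
begin

lemma inj_h: "inj_on h (carrier G)" and img_h: "h ` carrier G = carrier H"
  using iso by (auto simp: iso_def bij_betw_def)

lemma torsion_free_iso:
  assumes "torsion_free G"
  shows "torsion_free H"
  unfolding torsion_free_def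
proof (intro ballI allI impI)
  fix y and n :: nat assume y: "y \<in> carrier H" "0 < n" "y [^]\<^bsub>H\<^esub> n = \<one>\<^bsub>H\<^esub>"
  obtain g where g: "g \<in> carrier G" "y = h g" using y(1) img_h by auto
  then have "h (g [^] n) = h \<one>" using y(3) by (simp add: hom_nat_pow)
  then have "g [^] n = \<one>" using inj_h g by (simp add: inj_on_def)
  then have "g = \<one>" using assms g(1) y(2) unfolding torsion_free_def by blast
  then show "y = \<one>\<^bsub>H\<^esub>" using g(2) by simp
qed

lemma derived_series_trivial_iso:
  "(derived H ^^ n) (carrier H) = {\<one>\<^bsub>H\<^esub>} \<longleftrightarrow> (derived G ^^ n) (carrier G) = {\<one>}"
proof -
  have "(derived H ^^ n) (carrier H) = h ` ((derived G ^^ n) (carrier G))"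
    using exp_of_derived_img[of "carrier G" n] img_h by simp
  moreover have "(derived G ^^ n) (carrier G) \<subseteq> carrier G"
    using G.exp_of_derived_in_carrier by simp
  ultimately show ?thesis
    using inj_on_image_eq_iff[OF inj_h, of "(derived G ^^ n) (carrier G)" "{\<one>}"] by simp
qed

lemma step_solvable_iso: "step_solvable n G \<Longrightarrow> step_solvable n H"
  by (simp add: step_solvable_def derived_length_def G.solvable_iff_trivial_derived_seq
      H.solvable_iff_trivial_derived_seq derived_series_trivial_iso)

lemma foelner_iso:
  assumes "foelner G S" "S \<subseteq> carrier G"
  shows "foelner H (h ` S)"
  unfolding foelner_def
proof (intro allI impI)
  fix e :: real assume "e > 0"
  then obtain F where F: "finite F" "F \<noteq> {}" "F \<subseteq> carrier G"
    and small: "\<And>s. s \<in> S \<Longrightarrow> real (card ((\<lambda>g. s \<otimes> g) ` F - F)) \<le> e * real (card F)"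
    using assms(1)[unfolded foelner_def, rule_format, of e] by auto
  have inj: "card (h ` X) = card X" if "X \<subseteq> carrier G" for X
    using card_image[OF inj_on_subset[OF inj_h that]] .
  have "real (card ((\<lambda>g. s' \<otimes>\<^bsub>H\<^esub> g) ` (h ` F) - h ` F)) \<le> e * real (card (h ` F))" if s': "s' \<in> h ` S" for s'
  proof -
    obtain s where s: "s \<in> S" "s' = h s" using s' by auto
    have sc: "s \<in> carrier G" using s assms by auto
    have "(\<lambda>g. s' \<otimes>\<^bsub>H\<^esub> g) ` (h ` F) = h ` ((\<lambda>g. s \<otimes> g) ` F)"
      using F sc by (force simp: image_image s(2) subset_iff)
    then have "(\<lambda>g. s' \<otimes>\<^bsub>H\<^esub> g) ` (h ` F) - h ` F = h ` ((\<lambda>g. s \<otimes> g) ` F - F)"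
      using inj_on_image_set_diff[OF inj_h, of "(\<lambda>g. s \<otimes> g) ` F" F] F sc by auto
    moreover have "(\<lambda>g. s \<otimes> g) ` F - F \<subseteq> carrier G" using F sc by auto
    ultimately show ?thesis
      using small[OF s(1)] inj F(3) by simp
  qed
  then show "\<exists>F. finite F \<and> F \<noteq> {} \<and> F \<subseteq> carrier H \<and>
     (\<forall>s\<in>h ` S. real (card ((\<lambda>g. s \<otimes>\<^bsub>H\<^esub> g) ` F - F)) \<le> e * real (card F))"
    using F img_h by (intro exI[of _ "h ` F"]) auto
qed

lemma central_divisible_iso:
  assumes "central_divisible G p"
  shows "central_divisible H p"
proof -
  have centre: "{z \<in> carrier H. \<forall>g\<in>carrier H. z \<otimes>\<^bsub>H\<^esub> g = g \<otimes>\<^bsub>H\<^esub> z} =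
    h ` {z \<in> carrier G. \<forall>g\<in>carrier G. z \<otimes> g = g \<otimes> z}"
  proof -
    have "h z \<otimes>\<^bsub>H\<^esub> h g = h g \<otimes>\<^bsub>H\<^esub> h z \<longleftrightarrow> z \<otimes> g = g \<otimes> z" if "z \<in> carrier G" "g \<in> carrier G" for z g
      using that inj_on_eq_iff[OF inj_h, of "z \<otimes> g" "g \<otimes> z"] by simp
    then show ?thesis unfolding img_h[symmetric] by auto
  qed
  show ?thesis
    using assms unfolding central_divisible_def Let_def centre
    by (force simp: hom_nat_pow[symmetric])
qed

end

lemma group_isoI: "group G \<Longrightarrow> group H \<Longrightarrow> h \<in> iso G H \<Longrightarrow> group_iso G H h"
  by (simp add: group_iso_def group_iso_axioms_def group_hom_def group_hom_axioms_def iso_def)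

section \<open>The family of groups\<close>

definition hall_copy :: "nat set \<Rightarrow> nat monoid" where
  "hall_copy P = nat_copy (hall_group (localized_integers P) (centre_sequence P))"

lemma hall_copy_iso:
  obtains h where "group_iso (hall_group (localized_integers P) (centre_sequence P)) (hall_copy P) h"
proof -
  interpret hall_data "localized_integers P" "centre_sequence P"
    by (rule hall_data_localized)
  have "countable (carrier H)"
    by (rule countable_subset[OF subset_UNIV], unfold UNIV_Times_UNIV[symmetric])
      (intro countable_SIGMA countable_finitely_supported countableI_type)
  then show ?thesis
    using that group_isoI[OF is_group] nat_copy unfolding hall_copy_def by blast
qed

lemma central_divisible_hall_copy:
  assumes "prime p"
  shows "central_divisible (hall_copy P) p \<longleftrightarrow> p \<in> P"
proof -
  interpret hall_data "localized_integers P" "centre_sequence P"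
    by (rule hall_data_localized)
  obtain h where h: "group_iso H (hall_copy P) h" by (rule hall_copy_iso)
  then interpret h: group_iso H "hall_copy P" h .
  interpret h': group_iso "hall_copy P" H "inv_into (carrier H) h"
    using group_isoI[OF h.H.is_group is_group iso_set_sym[OF h.iso]] .
  have "central_divisible (hall_copy P) p \<longleftrightarrow> central_divisible H p"
    using h.central_divisible_iso[of p] h'.central_divisible_iso[of p] by (rule iffI[rotated])
  then show ?thesis
    by (simp only: central_divisible_hall localized_integers_divisible_iff[OF assms])
qed

text \<open>
\<open>P\<close> is the set of primes by which the centre is divisible, and this is an isomorphism invariant.
\<close>
lemma hall_copy_not_iso:
  assumes "P \<subseteq> {p. prime p}" "Q \<subseteq> {p. prime p}" "hall_copy P \<cong> hall_copy Q"
  shows "P = Q"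
proof -
  have group: "group (hall_copy R)" for R
    by (rule hall_copy_iso[of R]) (simp add: group_iso_def group_hom_def)
  interpret P: group "hall_copy P" by (rule group)
  interpret Q: group "hall_copy Q" by (rule group)
  obtain h where h: "h \<in> iso (hall_copy P) (hall_copy Q)"
    using assms(3) by (auto simp: is_iso_def)
  interpret h: group_iso "hall_copy P" "hall_copy Q" h
    using group_isoI h P.is_group Q.is_group by blast
  interpret h': group_iso "hall_copy Q" "hall_copy P" "inv_into (carrier (hall_copy P)) h"
    using group_isoI P.iso_set_sym[OF h] P.is_group Q.is_group by blast
  have "p \<in> P \<longleftrightarrow> p \<in> Q" if "prime p" for p
    using h.central_divisible_iso[of p] h'.central_divisible_iso[of p] central_divisible_hall_copy[OF that]
    by blast
  then show ?thesis using assms(1,2) by auto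
qed

lemma hall_copy_properties:
  "group (hall_copy P)" "torsion_free (hall_copy P)" "step_solvable 3 (hall_copy P)"
  "\<exists>x\<in>carrier (hall_copy P). \<exists>y\<in>carrier (hall_copy P).
     generate (hall_copy P) {x, y} = carrier (hall_copy P) \<and>
     group_spectrum (hall_copy P) {x, inv\<^bsub>hall_copy P\<^esub> x, y, inv\<^bsub>hall_copy P\<^esub> y} = complex_of_real ` {-1..1}"
proof -
  interpret hall_data "localized_integers P" "centre_sequence P"
    by (rule hall_data_localized)
  obtain h where "group_iso H (hall_copy P) h" by (rule hall_copy_iso)
  then interpret h: group_iso H "hall_copy P" h .
  show "group (hall_copy P)" by (rule h.H.is_group)
  show "torsion_free (hall_copy P)" by (rule h.torsion_free_iso[OF torsion_free_hall])
  show "step_solvable 3 (hall_copy P)" by (rule h.step_solvable_iso[OF step_solvable_hall])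
  have xy: "x\<^sub>0 \<in> carrier H" "y\<^sub>0 \<in> carrier H" by (simp_all add: zero_mem)
  let ?x = "h x\<^sub>0" and ?y = "h y\<^sub>0" and ?\<phi> = "\<lambda>g. fst (inv_into (carrier H) h g)"
  have gen: "generate (hall_copy P) {?x, ?y} = carrier (hall_copy P)"
    using h.generate_img[of "{x\<^sub>0, y\<^sub>0}"] xy h.img_h generate_hall by simp
  have \<phi>: "?\<phi> (h g) = fst g" if "g \<in> carrier H" for g
    using inv_into_f_f[OF h.inj_h that] by simp
  have "x\<^sub>0 \<noteq> y\<^sub>0"
    by (metis Pair_inject lookup_single_eq lookup_zero zero_neq_one)
  then have "?x \<noteq> ?y"
    using inj_onD[OF h.inj_h _ xy] by blast
  moreover have "?\<phi> (a \<otimes>\<^bsub>hall_copy P\<^esub> b) = ?\<phi> a + ?\<phi> b"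
    if ab: "a \<in> carrier (hall_copy P)" "b \<in> carrier (hall_copy P)" for a b
  proof -
    have "a \<in> h ` carrier H" "b \<in> h ` carrier H"
      using ab by (simp_all only: h.img_h)
    then obtain g k where gk: "g \<in> carrier H" "k \<in> carrier H" "a = h g" "b = h k"
      by (elim imageE)
    then have "a \<otimes>\<^bsub>hall_copy P\<^esub> b = h (g \<otimes>\<^bsub>H\<^esub> k)" by simp
    then show ?thesis using gk by (simp only: \<phi> m_closed hall_components)
  qed
  moreover have "foelner (hall_copy P) {?x, ?y}"
    using h.foelner_iso[OF foelner_hall] xy by simp
  moreover have "?\<phi> ?x = 1" "?\<phi> ?y = 1" using \<phi>[OF xy(1)] \<phi>[OF xy(2)] by simp_all
  ultimately have "group_spectrum (hall_copy P) {?x, inv\<^bsub>hall_copy P\<^esub> ?x, ?y, inv\<^bsub>hall_copy P\<^esub> ?y} = complex_of_real ` {-1..1}"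
    using xy by (intro h.H.group_spectrum_eq_interval[where \<phi> = ?\<phi>]) auto
  then show "\<exists>x\<in>carrier (hall_copy P). \<exists>y\<in>carrier (hall_copy P).
     generate (hall_copy P) {x, y} = carrier (hall_copy P) \<and>
     group_spectrum (hall_copy P) {x, inv\<^bsub>hall_copy P\<^esub> x, y, inv\<^bsub>hall_copy P\<^esub> y} = complex_of_real ` {-1..1}"
    using gen xy by (intro bexI[of _ ?x] bexI[of _ ?y]) auto
qed

theorem theorem1p4:
  shows "\<exists>F :: nat monoid set.
           F \<approx> (UNIV :: nat set set) \<and>
           (\<forall>G\<in>F. \<forall>H\<in>F. G \<noteq> H \<longrightarrow> \<not> G \<cong> H) \<and>
           (\<forall>G\<in>F. group G \<and> torsion_free G \<and> step_solvable 3 G \<and>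
              (\<exists>x\<in>carrier G. \<exists>y\<in>carrier G.
                 generate G {x, y} = carrier G \<and>
                 group_spectrum G {x, inv\<^bsub>G\<^esub> x, y, inv\<^bsub>G\<^esub> y} = complex_of_real ` {-1..1}))"
proof -
  let ?primes = "{p :: nat. prime p}"
  have "inj_on hall_copy (Pow ?primes)"
    using hall_copy_not_iso iso_refl by (metis PowD inj_onI)
  then have "hall_copy ` Pow ?primes \<approx> Pow ?primes"
    by (rule inj_on_image_eqpoll_self)
  also have "Pow ?primes \<approx> Pow (UNIV :: nat set)"
    using bij_betw_Pow[OF bij_enumerate[OF primes_infinite]] eqpoll_sym unfolding eqpoll_def by blast
  finally have "hall_copy ` Pow ?primes \<approx> (UNIV :: nat set set)" by simp
  moreover have "\<not> G \<cong> H" if "G \<in> hall_copy ` Pow ?primes" "H \<in> hall_copy ` Pow ?primes" "G \<noteq> H" for G H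
    using that hall_copy_not_iso by blast
  ultimately show ?thesis
    using hall_copy_properties by (intro exI[of _ "hall_copy ` Pow ?primes"]) blast
qed

end
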